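(* Let $X$ be a nonempty topological space with finite covering type $n=ct(X)$, and let $P_X(t)=h_0+h_1t+h_2t^2+\cdots$ be its Poincaré polynomial, where $h_i=\dim_k H_i(X;k)$ for a field $k$. Then $$P_X(t)\le \frac{(1+t)^{n-1}-1}{t}+1 = n+\binom{n-1}{2}t+\binom{n-1}{3}t^2+\cdots+t^{n-2}$$ coefficientwise. That is, $h_0\le n$, $h_i\le\binom{n-1}{i+1}$ for $1\le i\le n-2$, and $h_i=0$ for all $i\ge 1$ with $i\ge n-1$.
   Context: A good (open) cover of a topological space $X$ is a family of contractible open subspaces $U_i$ covering $X$ such that every nonempty intersection $U_{i_1}\cap\dots\cap U_{i_n}$ is contractible. The strict covering type of $X$ is the minimum number of elements in a good open cover of $X$. The covering type $ct(X)$ is the minimum of the strict covering types of spaces $X'$ homotopy equivalent to $X$. For polynomials $P,Q\in\mathbb{Z}[t]$, $P\le Q$ means that every coefficient of $P$ is less than or equal to the corresponding coefficient of $Q$. *)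

theory Defs
  imports
    "HOL-Homology.Homology"
    "HOL-Library.Extended_Nat"
    "Jordan_Normal_Form.VS_Connect"
begin

section \<open>Good covers and covering type\<close>

text \<open>The library counts the empty space as contractible, so nonemptiness of the members is
  required explicitly.\<close>

definition good_open_cover :: "'a topology \<Rightarrow> 'a set set \<Rightarrow> bool" where
  "good_open_cover X \<U> \<longleftrightarrow>
     \<Union>\<U> = topspace X \<and>
     (\<forall>U\<in>\<U>. openin X U \<and> U \<noteq> {} \<and> contractible_space (subtopology X U)) \<and>
     (\<forall>\<F>. finite \<F> \<and> \<F> \<noteq> {} \<and> \<F> \<subseteq> \<U> \<and> \<Inter>\<F> \<noteq> {} \<longrightarrow>
            contractible_space (subtopology X (\<Inter>\<F>)))"

definition strict_covering_type :: "'a topology \<Rightarrow> enat" where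
  "strict_covering_type X =
     (INF \<U> \<in> {\<U>. good_open_cover X \<U>}. if finite \<U> then enat (card \<U>) else \<infinity>)"

text \<open>A formula cannot quantify over the carrier types of the spaces homotopy equivalent
  to \<open>X\<close>. Carriers inside \<^typ>\<open>'a \<times> real\<close> suffice: by theorem \<open>covering_type_le\<close> below, no space
  homotopy equivalent to \<open>X\<close>, over any type whatsoever, has a smaller strict covering type.\<close>

definition covering_type :: "'a topology \<Rightarrow> enat" where
  "covering_type X =
     (INF Y \<in> {Y :: ('a \<times> real) topology. Y homotopy_equivalent_space X}. strict_covering_type Y)"


subsection \<open>Independence of the carrier type\<close>

lemma ex_inj_seq_real: "\<exists>e :: (nat \<Rightarrow> real) \<Rightarrow> real. inj e"
proof -
  obtain b :: "nat set \<Rightarrow> real" where b: "inj b"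
    using nat_sets_eqpoll_reals by (auto simp: eqpoll_def bij_def)
  obtain d :: "real \<Rightarrow> nat set" where d: "inj d"
    using eqpoll_sym [OF nat_sets_eqpoll_reals] by (auto simp: eqpoll_def bij_def)
  define E where "E s = {n. snd (prod_decode n) \<in> d (s (fst (prod_decode n)))}"
    for s :: "nat \<Rightarrow> real"
  have "inj E"
  proof (rule injI, rule ext)
    fix s s' i assume "E s = E s'"
    then have "prod_encode (i, j) \<in> E s \<longleftrightarrow> prod_encode (i, j) \<in> E s'" for j
      by simp
    then have "d (s i) = d (s' i)"
      by (auto simp: E_def)
    then show "s i = s' i"
      using d by (simp add: inj_eq)
  qed
  then have "inj (b \<circ> E)"
    using b by (simp add: inj_compose)
  then show ?thesis by blast
qed

lemma ex_inj_words:
  "\<exists>e :: 'a \<times> nat \<times> (nat \<times> real) list \<Rightarrow> 'a \<times> real. inj e"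
proof -
  obtain e :: "(nat \<Rightarrow> real) \<Rightarrow> real" where e: "inj e"
    using ex_inj_seq_real by blast
  define E where "E k w = case_nat (real k) (case_nat (real (length w))
      (\<lambda>i. let q = w ! (i div 2) in if even i then real (fst q) else snd q))"
    for k and w :: "(nat \<times> real) list"
  have "k = k' \<and> w = w'" if eq: "E k w = E k' w'" for k k' w w'
  proof -
    have "k = k'" using fun_cong [OF eq, of 0] by (simp add: E_def)
    moreover have len: "length w = length w'" using fun_cong [OF eq, of "Suc 0"] by (simp add: E_def)
    moreover have "w ! i = w' ! i" for i
      using fun_cong [OF eq, of "Suc (Suc (2 * i))"] fun_cong [OF eq, of "Suc (Suc (2 * i + 1))"]
      by (simp add: E_def Let_def prod_eq_iff)
    ultimately show ?thesis by (simp add: list_eq_iff_nth_eq)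
  qed
  then have "inj (\<lambda>(x :: 'a, k, w). (x, e (E k w)))"
    using injD [OF e] by (intro injI) (auto, blast+)
  then show ?thesis by blast
qed

lemma continuous_map_homotopy_restrict:
  assumes "continuous_map (prod_topology (top_of_set {0..1::real}) X) Y h"
    and "\<And>t x. t \<in> {0..1} \<Longrightarrow> x \<in> topspace X \<inter> S \<Longrightarrow> h (t, x) \<in> T"
  shows "continuous_map (prod_topology (top_of_set {0..1}) (subtopology X S)) (subtopology Y T) h"
proof -
  have "continuous_map (subtopology (prod_topology (top_of_set {0..1::real}) X) (UNIV \<times> S)) Y h"
    using assms(1) by (rule continuous_map_from_subtopology)
  then show ?thesis
    using assms(2)
    by (auto simp: continuous_map_in_subtopology prod_topology_subtopology subtopology_subtopology
       Times_Int_Times)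
qed

lemma good_open_coverD:
  assumes "good_open_cover X \<U>" "finite \<F>" "\<F> \<noteq> {}" "\<F> \<subseteq> \<U>" "\<Inter>\<F> \<noteq> {}"
  shows "contractible_space (subtopology X (\<Inter>\<F>))"
  using assms by (simp add: good_open_cover_def)

lemma good_open_cover_homeomorphic:
  assumes e: "homeomorphic_map X Y e" and good: "good_open_cover X \<U>"
  shows "good_open_cover Y ((`) e ` \<U>)"
proof -
  have sub: "U \<subseteq> topspace X" if "U \<in> \<U>" for U
    using good that unfolding good_open_cover_def by blast
  have inj: "inj_on e (topspace X)" and surj: "e ` topspace X = topspace Y"
    using e by (auto simp: homeomorphic_eq_everything_map)
  have contr: "contractible_space (subtopology Y (e ` V))"
    if "V \<subseteq> topspace X" "contractible_space (subtopology X V)" for V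
  proof -
    have "homeomorphic_map (subtopology X V) (subtopology Y (e ` V)) e"
      using that surj by (intro homeomorphic_map_subtopologies [OF e]) auto
    then show ?thesis
      using that homeomorphic_map_imp_homeomorphic_space homeomorphic_space_contractibility by blast
  qed
  show ?thesis
    unfolding good_open_cover_def
  proof (intro conjI ballI allI impI)
    show "\<Union> ((`) e ` \<U>) = topspace Y"
      using good surj unfolding good_open_cover_def by (metis image_Union)
  next
    fix V assume "V \<in> (`) e ` \<U>"
    then obtain U where U: "U \<in> \<U>" "V = e ` U" by blast
    then have "openin X U" "U \<noteq> {}" "contractible_space (subtopology X U)"
      using good by (auto simp: good_open_cover_def)
    then show "openin Y V" "V \<noteq> {}" "contractible_space (subtopology Y V)"
      using U sub contr homeomorphic_map_openness_eq [OF e] by auto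
  next
    fix \<F>' assume \<F>': "finite \<F>' \<and> \<F>' \<noteq> {} \<and> \<F>' \<subseteq> (`) e ` \<U> \<and> \<Inter>\<F>' \<noteq> {}"
    then obtain \<F> where \<F>: "finite \<F>" "\<F> \<subseteq> \<U>" "\<F>' = (`) e ` \<F>"
      using finite_subset_image by metis
    then have "\<F> \<noteq> {}" using \<F>' by auto
    then obtain j where "j \<in> \<F>" by blast
    then have Int: "\<Inter>\<F>' = e ` \<Inter>\<F>"
      using \<F> sub image_INT [OF inj, of \<F> "\<lambda>U. U" j] by (metis image_ident subsetD)
    then have "\<Inter>\<F> \<noteq> {}" using \<F>' by force
    then have "contractible_space (subtopology X (\<Inter>\<F>))"
      using good_open_coverD [OF good] \<F> \<open>\<F> \<noteq> {}\<close> by simp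
    moreover have "\<Inter>\<F> \<subseteq> topspace X"
      using \<F> \<open>\<F> \<noteq> {}\<close> sub by blast
    ultimately show "contractible_space (subtopology Y (\<Inter>\<F>'))"
      using contr Int by simp
  qed
qed

lemma homeomorphic_map_pullback:
  assumes "inj_on e (topspace X)"
  shows "homeomorphic_map X (pullback_topology (e ` topspace X) (inv_into (topspace X) e) X) e"
proof -
  let ?i = "inv_into (topspace X) e"
  let ?Z = "pullback_topology (e ` topspace X) ?i X"
  have "continuous_map X ?Z e"
    by (rule continuous_map_pullback')
      (auto intro: continuous_map_eq [where f = id] simp: assms)
  moreover have "continuous_map ?Z X (id \<circ> ?i)"
    by (rule continuous_map_pullback) simp
  ultimately have "homeomorphic_maps X ?Z e ?i"
    by (auto simp: homeomorphic_maps_def assms topspace_pullback_topology f_inv_into_f)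
  then show ?thesis
    using homeomorphic_maps_map by blast
qed

theorem covering_type_le:
  fixes X :: "'a topology" and Y :: "'b topology"
  assumes "Y homotopy_equivalent_space X"
  shows "covering_type X \<le> strict_covering_type Y"
proof (cases "strict_covering_type Y")
  case (enat n)
  let ?c = "\<lambda>\<U>. if finite \<U> then enat (card \<U>) else \<infinity>"
  have "Inf (?c ` Collect (good_open_cover Y)) = enat n"
    using enat by (simp add: strict_covering_type_def)
  then have "enat n \<in> ?c ` Collect (good_open_cover Y)"
    unfolding Inf_enat_def by (metis (mono_tags, lifting) LeastI enat.distinct(2) ex_in_conv)
  then obtain \<U> where good: "good_open_cover Y \<U>" and fin: "finite \<U>" and card: "card \<U> = n"
    by (auto split: if_splits)
  obtain f g where f: "continuous_map X Y f" and g: "continuous_map Y X g"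
    and gf: "homotopic_with (\<lambda>x. True) X X (g \<circ> f) id"
    and fg: "homotopic_with (\<lambda>x. True) Y Y (f \<circ> g) id"
    using assms unfolding homotopy_equivalent_space_def by blast
  obtain h where h: "continuous_map (prod_topology (top_of_set {0..1::real}) Y) Y h"
    "\<And>x. h (0, x) = (f \<circ> g) x" "\<And>x. h (1, x) = x"
    using fg unfolding homotopic_with_def by auto
  define G where "G = {\<F>. \<F> \<subseteq> \<U> \<and> \<F> \<noteq> {} \<and> \<Inter>\<F> \<noteq> {}}"
  have "countable G"
    using fin unfolding G_def by (intro countable_finite) (auto intro: finite_subset [of _ "Pow \<U>"])
  have sub: "U \<subseteq> topspace Y" if "U \<in> \<U>" for U
    using good that by (auto simp: good_open_cover_def)
  have G_top: "\<Inter>\<F> \<subseteq> topspace Y" if "\<F> \<in> G" for \<F>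
  proof -
    obtain U where "U \<in> \<F>" "U \<in> \<U>" using \<open>\<F> \<in> G\<close> by (auto simp: G_def)
    then show ?thesis using sub by blast
  qed
  have "\<forall>\<F>\<in>G. \<exists>c a. continuous_map (prod_topology (top_of_set {0..1::real})
          (subtopology Y (\<Inter>\<F>))) (subtopology Y (\<Inter>\<F>)) c \<and> (\<forall>x. c (0, x) = x) \<and> (\<forall>x. c (1, x) = a)"
  proof
    fix \<F> assume "\<F> \<in> G"
    then have "contractible_space (subtopology Y (\<Inter>\<F>))"
      using good_open_coverD [OF good] finite_subset [OF _ fin] unfolding G_def by simp
    then show "\<exists>c a. continuous_map (prod_topology (top_of_set {0..1::real})
          (subtopology Y (\<Inter>\<F>))) (subtopology Y (\<Inter>\<F>)) c \<and> (\<forall>x. c (0, x) = x) \<and> (\<forall>x. c (1, x) = a)"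
      unfolding contractible_space_def homotopic_with_def by auto
  qed
  then obtain c a where c: "\<And>\<F>. \<F> \<in> G \<Longrightarrow> continuous_map (prod_topology (top_of_set {0..1::real})
          (subtopology Y (\<Inter>\<F>))) (subtopology Y (\<Inter>\<F>)) (c \<F>)"
    "\<And>\<F> x. \<F> \<in> G \<Longrightarrow> c \<F> (0, x) = x" "\<And>\<F> x. \<F> \<in> G \<Longrightarrow> c \<F> (1, x) = a \<F>"
    by metis
  define F where "F = from_nat_into G"
  have F: "\<exists>k. F k = \<F>" if "\<F> \<in> G" for \<F>
    unfolding F_def using \<open>countable G\<close> that by (metis from_nat_into_to_nat_on)
  define step where "step = (\<lambda>(i, t) y. case i of 0 \<Rightarrow> h (t, y) | Suc k \<Rightarrow> c (F k) (t, y))"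
  define start where "start x i = (case i of 0 \<Rightarrow> f x | Suc k \<Rightarrow> SOME y. y \<in> \<Inter>(F k))" for x and i :: nat
  define word where "word = (\<lambda>(x, i, w). foldr step w (start x i))"
  define S where "S = range word \<inter> topspace Y"
  have word_Cons: "step s (word (x, i, w)) = word (x, i, s # w)" for s x i w
    by (simp add: word_def)
  have S_step: "step s y \<in> S" if "y \<in> S" "step s y \<in> topspace Y" for s y
    using that word_Cons unfolding S_def by (metis IntE IntI imageE rangeI prod_cases3)
  have S_start: "start x i \<in> S" if "start x i \<in> topspace Y" for x i
  proof -
    have "start x i = word (x, i, [])" by (simp add: word_def)
    then show ?thesis using that by (metis IntI S_def rangeI)
  qed
  have fS: "f x \<in> S" if "x \<in> topspace X" for x
    using S_start [of x 0] f that by (auto simp: start_def continuous_map_def)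
  have hS: "h (t, y) \<in> S" if "t \<in> {0..1}" "y \<in> S" for t y
  proof -
    have "h (t, y) \<in> topspace Y"
      using h(1) that by (auto simp: continuous_map_def S_def)
    then show ?thesis using S_step [of y "(0, t)"] that by (simp add: step_def)
  qed
  have cS: "c \<F> (t, y) \<in> S \<inter> \<Inter>\<F>" if "t \<in> {0..1}" "y \<in> S \<inter> \<Inter>\<F>" "\<F> \<in> G" for \<F> t y
  proof -
    obtain k where k: "F k = \<F>" using F \<open>\<F> \<in> G\<close> by blast
    have "(t, y) \<in> topspace (prod_topology (top_of_set {0..1::real}) (subtopology Y (\<Inter>\<F>)))"
      using that by (auto simp: S_def)
    then have "c \<F> (t, y) \<in> topspace (subtopology Y (\<Inter>\<F>))"
      using continuous_map_image_subset_topspace [OF c(1) [OF \<open>\<F> \<in> G\<close>]] by blast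
    then have "c \<F> (t, y) \<in> topspace Y" "c \<F> (t, y) \<in> \<Inter>\<F>"
      by auto
    then show ?thesis using S_step [of y "(Suc k, t)"] that k by (simp add: step_def)
  qed
  have meet: "S \<inter> \<Inter>\<F> \<noteq> {}" if "\<F> \<in> G" for \<F>
  proof -
    obtain k where k: "F k = \<F>" using F \<open>\<F> \<in> G\<close> by blast
    have "start undefined (Suc k) \<in> \<Inter>\<F>"
      using that k some_in_eq [of "\<Inter>\<F>"] unfolding start_def G_def by simp
    then show ?thesis
      using S_start G_top [OF that] by blast
  qed
  define Y' where "Y' = subtopology Y S"
  have top: "topspace Y' = S"
    unfolding Y'_def S_def by auto
  have htpy: "Y' homotopy_equivalent_space X"
    unfolding homotopy_equivalent_space_def
  proof (intro exI conjI)
    show "continuous_map X Y' f"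
      using f fS by (auto simp: Y'_def continuous_map_in_subtopology)
    show "continuous_map Y' X g"
      using g by (simp add: Y'_def continuous_map_from_subtopology)
    have "continuous_map (prod_topology (top_of_set {0..1::real}) Y') Y' h"
      unfolding Y'_def using hS by (intro continuous_map_homotopy_restrict [OF h(1)]) auto
    then show "homotopic_with (\<lambda>x. True) Y' Y' (f \<circ> g) id"
      unfolding homotopic_with_def using h by auto
  qed (fact gf)
  have contr: "contractible_space (subtopology Y' (S \<inter> \<Inter>\<F>))" if "\<F> \<in> G" for \<F>
  proof -
    have eq: "subtopology Y' (S \<inter> \<Inter>\<F>) = subtopology (subtopology Y (\<Inter>\<F>)) (S \<inter> \<Inter>\<F>)"
      unfolding Y'_def subtopology_subtopology by (rule arg_cong [where f = "subtopology Y"]) blast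
    have "continuous_map (prod_topology (top_of_set {0..1::real}) (subtopology Y' (S \<inter> \<Inter>\<F>)))
       (subtopology Y' (S \<inter> \<Inter>\<F>)) (c \<F>)"
      unfolding eq using cS that by (intro continuous_map_homotopy_restrict c) auto
    then show ?thesis
      unfolding contractible_space_def homotopic_with_def using c(2,3) that
      by (intro exI [where x = "a \<F>"] exI [where x = "c \<F>"]) auto
  qed
  define \<V> where "\<V> = (\<lambda>U. S \<inter> U) ` \<U>"
  have good': "good_open_cover Y' \<V>"
    unfolding good_open_cover_def
  proof (intro conjI ballI allI impI)
    show "\<Union>\<V> = topspace Y'"
      using good unfolding \<V>_def top good_open_cover_def S_def by auto
  next
    fix V assume "V \<in> \<V>"
    then obtain U where U: "U \<in> \<U>" "V = S \<inter> U" unfolding \<V>_def by blast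
    then have op: "openin Y U" and "{U} \<in> G"
      using good by (auto simp: good_open_cover_def G_def)
    then show "V \<noteq> {}" "contractible_space (subtopology Y' V)"
      using meet [of "{U}"] contr [of "{U}"] U by auto
    show "openin Y' V"
      using op U by (auto simp: Y'_def openin_subtopology)
  next
    fix \<F>' assume \<F>': "finite \<F>' \<and> \<F>' \<noteq> {} \<and> \<F>' \<subseteq> \<V> \<and> \<Inter>\<F>' \<noteq> {}"
    then obtain \<F> where \<F>: "\<F> \<subseteq> \<U>" "\<F>' = (\<lambda>U. S \<inter> U) ` \<F>"
      unfolding \<V>_def by (metis finite_subset_image)
    then have "\<F> \<noteq> {}" using \<F>' by auto
    then have Int: "\<Inter>\<F>' = S \<inter> \<Inter>\<F>" using \<F> by auto
    then have "\<F> \<in> G" using \<F> \<F>' \<open>\<F> \<noteq> {}\<close> by (auto simp: G_def)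
    then show "contractible_space (subtopology Y' (\<Inter>\<F>'))"
      using contr Int by simp
  qed
  obtain w :: "'a \<times> nat \<times> (nat \<times> real) list \<Rightarrow> 'a \<times> real" where w: "inj w"
    using ex_inj_words by blast
  define e where "e = w \<circ> inv_into UNIV word"
  have "inj_on e S"
    unfolding e_def S_def using w
    by (intro comp_inj_on) (auto intro: inj_on_subset [OF inj_on_inv_into] inj_on_subset)
  define Z where "Z = pullback_topology (e ` topspace Y') (inv_into (topspace Y') e) Y'"
  have hom: "homeomorphic_map Y' Z e"
    unfolding Z_def by (rule homeomorphic_map_pullback) (simp add: top \<open>inj_on e S\<close>)
  have "Z homotopy_equivalent_space X"
    using hom htpy homeomorphic_map_imp_homeomorphic_space homeomorphic_imp_homotopy_equivalent_space
      homotopy_equivalent_space_sym homotopy_eqv_trans by metis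
  then have "covering_type X \<le> strict_covering_type Z"
    unfolding covering_type_def by (intro INF_lower) simp
  also have "\<dots> \<le> enat (card ((`) e ` \<V>))"
    using good_open_cover_homeomorphic [OF hom good'] fin
    unfolding strict_covering_type_def \<V>_def by (intro INF_lower2) auto
  also have "\<dots> \<le> enat n"
    using fin card card_image_le [of \<V> "(`) e"] card_image_le [of \<U> "\<lambda>U. S \<inter> U"]
    unfolding \<V>_def by simp
  finally show ?thesis
    using enat by simp
qed simp


section \<open>Singular homology with coefficients in a field\<close>

type_synonym ('a, 'k) kchain = "((nat \<Rightarrow> real) \<Rightarrow> 'a) \<Rightarrow>\<^sub>0 'k"

definition singular_kchain :: "nat \<Rightarrow> 'a topology \<Rightarrow> ('a, 'k::field) kchain \<Rightarrow> bool" where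
  "singular_kchain p X c \<longleftrightarrow> Poly_Mapping.keys c \<subseteq> singular_simplex_set p X"

definition kchain_boundary :: "nat \<Rightarrow> ('a, 'k::field) kchain \<Rightarrow> ('a, 'k) kchain" where
  "kchain_boundary p c =
     (if p = 0 then 0
      else \<Sum>f\<in>Poly_Mapping.keys c. \<Sum>i\<le>p.
             Poly_Mapping.single (singular_face p i f) ((-1) ^ i * Poly_Mapping.lookup c f))"

definition kcycles :: "nat \<Rightarrow> 'a topology \<Rightarrow> ('a, 'k::field) kchain set" where
  "kcycles p X = {c. singular_kchain p X c \<and> kchain_boundary p c = 0}"

definition kboundaries :: "nat \<Rightarrow> 'a topology \<Rightarrow> ('a, 'k::field) kchain set" where
  "kboundaries p X = kchain_boundary (Suc p) ` {d. singular_kchain (Suc p) X d}"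

text \<open>A module record extends a ring record; the fields \<open>mult\<close> and \<open>one\<close> are unused.\<close>

definition kcycle_space :: "nat \<Rightarrow> 'a topology \<Rightarrow> ('k::field, ('a, 'k) kchain) module" where
  "kcycle_space p X =
     \<lparr>carrier = kcycles p X, mult = (\<lambda>_ _. 0), one = 0, zero = 0, add = (+),
      smult = (\<lambda>a. Poly_Mapping.map ((*) a))\<rparr>"

definition quotient_module :: "('k, 'c, 'm) module_scheme \<Rightarrow> 'c set \<Rightarrow> ('k, 'c set) module" where
  "quotient_module M N =
     \<lparr>carrier = a_rcosets\<^bsub>M\<^esub> N, mult = (\<lambda>_ _. N), one = N, zero = N, add = set_add M,
      smult = (\<lambda>a C. \<Union>x\<in>C. N +>\<^bsub>M\<^esub> (a \<odot>\<^bsub>M\<^esub> x))\<rparr>"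

definition homology_space :: "nat \<Rightarrow> 'a topology \<Rightarrow> ('k::field, ('a, 'k) kchain set) module" where
  "homology_space p X = quotient_module (kcycle_space p X) (kboundaries p X)"

subsection \<open>Homology is a vector space\<close>

lemma lookup_smult: "Poly_Mapping.lookup (Poly_Mapping.map ((*) a) c) f = a * Poly_Mapping.lookup c (f::'b)" 
  for a :: "'k::field"
  by (simp add: Poly_Mapping.map.rep_eq when_def)

lemma kchain_boundary_superset:
  assumes "finite K" "Poly_Mapping.keys c \<subseteq> K" "p \<noteq> 0"
  shows "kchain_boundary p c = (\<Sum>f\<in>K. \<Sum>i\<le>p.
           Poly_Mapping.single (singular_face p i f) ((-1) ^ i * Poly_Mapping.lookup c f))"
  unfolding kchain_boundary_def using assms
  by (auto simp: in_keys_iff intro!: sum.mono_neutral_left sum.neutral)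

lemma kchain_boundary_0 [simp]: "kchain_boundary p 0 = 0"
  by (simp add: kchain_boundary_def)

lemma kchain_boundary_add:
  "kchain_boundary p (c + d) = kchain_boundary p c + kchain_boundary p d"
proof (cases "p = 0")
  case False
  let ?K = "Poly_Mapping.keys c \<union> Poly_Mapping.keys d"
  note * = kchain_boundary_superset [where K = "?K" and p = p]
  have "Poly_Mapping.keys (c + d) \<subseteq> ?K" by (rule Poly_Mapping.keys_add)
  then show ?thesis using False
    by (subst (1 2 3) *) (auto simp: lookup_add distrib_left single_add sum.distrib)
qed (simp add: kchain_boundary_def)

lemma kchain_boundary_smult:
  "kchain_boundary p (Poly_Mapping.map ((*) a) c) = Poly_Mapping.map ((*) a) (kchain_boundary p c)"
proof (cases "p = 0")
  case True
  then show ?thesis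
    by (auto simp: kchain_boundary_def intro!: poly_mapping_eqI simp: lookup_smult)
next
  case False
  have keys: "Poly_Mapping.keys (Poly_Mapping.map ((*) a) c) \<subseteq> Poly_Mapping.keys c"
    by (auto simp: in_keys_iff lookup_smult)
  show ?thesis
    using False keys
    by (subst (1 2) kchain_boundary_superset [where K = "Poly_Mapping.keys c"])
      (auto intro!: poly_mapping_eqI sum.cong
        simp: lookup_smult lookup_sum lookup_single sum_distrib_left when_def)
qed

lemma kchain_boundary_sum:
  "kchain_boundary p (\<Sum>x\<in>A. F x) = (\<Sum>x\<in>A. kchain_boundary p (F x))"
  by (induction A rule: infinite_finite_induct) (auto simp: kchain_boundary_add)

lemma kchain_boundary_boundary:
  fixes c :: "('a, 'k::field) kchain"
  assumes "singular_kchain (Suc p) X c"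
  shows "kchain_boundary p (kchain_boundary (Suc p) c) = 0"
proof -
  define J :: "'k \<Rightarrow> 'a chain \<Rightarrow> ('a, 'k) kchain"
    where "J a z = Poly_Mapping.map (\<lambda>m. of_int m * a) z" for a z
  have lookup_J: "Poly_Mapping.lookup (J a z) f = of_int (Poly_Mapping.lookup z f) * a" for a z f
    by (simp add: J_def Poly_Mapping.map.rep_eq when_def)
  have J_0: "J a 0 = 0" for a
    by (rule poly_mapping_eqI) (simp add: lookup_J)
  have J_add: "J a (y + z) = J a y + J a z" for a y z
    by (rule poly_mapping_eqI) (simp add: lookup_J lookup_add algebra_simps)
  have J_diff: "J a (y - z) = J a y - J a z" for a y z
    by (rule poly_mapping_eqI) (simp add: lookup_J lookup_minus algebra_simps)
  have J_sum: "J a (\<Sum>i\<in>I. F i) = (\<Sum>i\<in>I. J a (F i))" for a I and F :: "nat \<Rightarrow> 'a chain"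
    by (induction I rule: infinite_finite_induct) (auto simp: J_0 J_add)
  have J_of: "J a (frag_of f) = Poly_Mapping.single f a" for a f
    by (rule poly_mapping_eqI) (simp add: lookup_J lookup_single when_def)
  have J_cmul: "J a (frag_cmul ((-1)^i) (frag_of f)) = Poly_Mapping.single f ((-1)^i * a)" for a i f
    by (rule poly_mapping_eqI) (simp add: lookup_J lookup_single when_def)
  have kdiff: "kchain_boundary q (c - d) = kchain_boundary q c - kchain_boundary q d"
    for q and c d :: "('a, 'k) kchain"
    using kchain_boundary_add [of q "c - d" d] by simp
  have bd: "kchain_boundary q (J a z) = J a (chain_boundary q z)" for q a z
  proof (rule frag_induction [of z UNIV])
    show "kchain_boundary q (J a (frag_of f)) = J a (chain_boundary q (frag_of f))" for f
    proof (cases "a = 0")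
      case True
      then have "J a y = 0" for y
        by (intro poly_mapping_eqI) (simp add: lookup_J)
      then show ?thesis by simp
    next
      case False
      then show ?thesis
        by (simp add: kchain_boundary_def chain_boundary_def J_of J_0 J_sum J_cmul)
    qed
  qed (auto simp: J_0 J_diff kdiff chain_boundary_diff)
  have c: "c = (\<Sum>f\<in>Poly_Mapping.keys c. J (Poly_Mapping.lookup c f) (frag_of f))"
    unfolding J_of
    by (rule poly_mapping_eqI) (auto simp: lookup_sum lookup_single when_def in_keys_iff)
  have "kchain_boundary p (kchain_boundary (Suc p) (J a (frag_of f))) = 0"
    if "f \<in> Poly_Mapping.keys c" for f a
  proof -
    have "singular_chain (Suc p) X (frag_of f)"
      using that assms by (auto simp: singular_kchain_def singular_chain_of)
    then show ?thesis
      using chain_boundary_boundary_alt by (fastforce simp: bd J_0)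
  qed
  then show ?thesis
    by (subst c) (simp add: kchain_boundary_sum)
qed

lemma singular_kchain_boundary:
  assumes "singular_kchain (Suc p) X c"
  shows "singular_kchain p X (kchain_boundary (Suc p) c)"
  unfolding singular_kchain_def
proof
  fix g assume "g \<in> Poly_Mapping.keys (kchain_boundary (Suc p) c)"
  then have "Poly_Mapping.lookup (kchain_boundary (Suc p) c) g \<noteq> 0"
    by (simp add: in_keys_iff)
  then have "(\<Sum>f\<in>Poly_Mapping.keys c. \<Sum>i\<le>Suc p. Poly_Mapping.lookup
     (Poly_Mapping.single (singular_face (Suc p) i f) ((-1) ^ i * Poly_Mapping.lookup c f)) g) \<noteq> 0"
    by (simp add: kchain_boundary_def lookup_sum del: sum.atMost_Suc)
  then obtain f i where "f \<in> Poly_Mapping.keys c" "i \<le> Suc p" "g = singular_face (Suc p) i f"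
    by (metis (no_types, lifting) atMost_iff lookup_single_not_eq sum.not_neutral_contains_not_neutral)
  then show "g \<in> singular_simplex_set p X"
    using assms singular_simplex_singular_face [of "Suc p" X f i] by (auto simp: singular_kchain_def)
qed

lemma singular_kchain_0 [simp]: "singular_kchain p X 0"
  by (simp add: singular_kchain_def)

lemma singular_kchain_add:
  "singular_kchain p X c \<Longrightarrow> singular_kchain p X d \<Longrightarrow> singular_kchain p X (c + d)"
  unfolding singular_kchain_def using Poly_Mapping.keys_add [of c d] by blast

lemma singular_kchain_smult:
  "singular_kchain p X c \<Longrightarrow> singular_kchain p X (Poly_Mapping.map ((*) a) c)"
  by (auto simp: singular_kchain_def in_keys_iff lookup_smult)

lemma vectorspace_kcycle_space:
  "vectorspace class_ring (kcycle_space p X :: ('k::field, ('a, 'k) kchain) module)"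
proof -
  let ?M = "kcycle_space p X :: ('k, ('a, 'k) kchain) module"
  have neg: "- c = Poly_Mapping.map ((*) (- 1)) c" for c :: "('a, 'k) kchain"
    by (rule poly_mapping_eqI) (simp add: lookup_smult)
  have "abelian_group ?M"
  proof (rule abelian_groupI)
    fix x assume "x \<in> carrier ?M"
    then have "- x \<in> carrier ?M"
      unfolding neg
      by (auto simp: kcycle_space_def kcycles_def singular_kchain_smult kchain_boundary_smult
          intro!: poly_mapping_eqI simp: lookup_smult)
    then show "\<exists>y\<in>carrier ?M. y \<oplus>\<^bsub>?M\<^esub> x = \<zero>\<^bsub>?M\<^esub>"
      by (rule bexI [rotated]) (simp add: kcycle_space_def)
  qed (auto simp: kcycle_space_def kcycles_def singular_kchain_add kchain_boundary_add algebra_simps)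
  moreover have "field (class_ring :: 'k ring)" by (rule class_field)
  ultimately have "Module.module class_ring ?M"
    by (intro moduleI fieldE(1))
      (auto simp: kcycle_space_def kcycles_def singular_kchain_smult
        kchain_boundary_smult lookup_smult lookup_add algebra_simps
        intro!: poly_mapping_eqI)
  then show ?thesis
    by (simp add: vectorspace_def class_field)
qed

lemma submodule_kboundaries:
  "Module.submodule (kboundaries p X) class_ring
     (kcycle_space p X :: ('k::field, ('a, 'k) kchain) module)"
proof -
  let ?M = "kcycle_space p X :: ('k, ('a, 'k) kchain) module"
  interpret V: vectorspace class_ring ?M
    by (rule vectorspace_kcycle_space)
  have sub: "kboundaries p X \<subseteq> carrier ?M"
    by (auto simp: kboundaries_def kcycle_space_def kcycles_def singular_kchain_boundary
        kchain_boundary_boundary)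
  have smult: "a \<odot>\<^bsub>?M\<^esub> x \<in> kboundaries p X" if "x \<in> kboundaries p X" for a x
    using that
    by (auto simp: kboundaries_def kcycle_space_def kchain_boundary_smult [symmetric]
        singular_kchain_smult)
  show ?thesis
  proof (rule V.submoduleI)
    show "\<zero>\<^bsub>?M\<^esub> \<in> kboundaries p X"
      by (auto simp: kboundaries_def kcycle_space_def intro: image_eqI [where x = 0])
    show "\<ominus>\<^bsub>?M\<^esub> a \<in> kboundaries p X" if "a \<in> kboundaries p X" for a
    proof -
      have "\<ominus>\<^bsub>?M\<^esub> a = (- 1) \<odot>\<^bsub>?M\<^esub> a"
        using that sub V.smult_l_minus [of 1 a] V.smult_one [of a] by (auto simp: class_ring_simps)
      then show ?thesis using smult [OF that] by simp
    qed
    show "a \<oplus>\<^bsub>?M\<^esub> b \<in> kboundaries p X" if "a \<in> kboundaries p X" "b \<in> kboundaries p X" for a b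
      using that
      by (auto simp: kboundaries_def kcycle_space_def kchain_boundary_add [symmetric]
          singular_kchain_add)
  qed (use sub smult in auto)
qed

lemma module_quotient_module:
  assumes "Module.module R M" "Module.submodule N R M"
  shows "Module.module R (quotient_module M N)"
proof -
  interpret Module.module R M by fact
  interpret N: abelian_subgroup N M
    by (rule abelian_subgroupI3)
      (use assms(2) in \<open>auto simp: Module.submodule_def additive_subgroup_def abelian_group_axioms\<close>)
  let ?Q = "quotient_module M N"
  have closed: "a \<odot>\<^bsub>M\<^esub> x \<in> N" if "a \<in> carrier R" "x \<in> N" for a x
    using assms(2) that by (rule Module.submodule.smult_closed)
  have smult: "smult ?Q a (N +>\<^bsub>M\<^esub> x) = N +>\<^bsub>M\<^esub> (a \<odot>\<^bsub>M\<^esub> x)"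
    if "a \<in> carrier R" "x \<in> carrier M" for a x
  proof -
    have const: "N +>\<^bsub>M\<^esub> (a \<odot>\<^bsub>M\<^esub> y) = N +>\<^bsub>M\<^esub> (a \<odot>\<^bsub>M\<^esub> x)" if y: "y \<in> N +>\<^bsub>M\<^esub> x" for y
    proof -
      obtain z where z: "z \<in> N" "y = z \<oplus>\<^bsub>M\<^esub> x"
        using y by (auto simp: a_r_coset_def r_coset_def)
      then have "a \<odot>\<^bsub>M\<^esub> y = a \<odot>\<^bsub>M\<^esub> z \<oplus>\<^bsub>M\<^esub> a \<odot>\<^bsub>M\<^esub> x"
        using \<open>a \<in> carrier R\<close> \<open>x \<in> carrier M\<close> N.a_subset by (auto simp: smult_r_distr)
      then have "a \<odot>\<^bsub>M\<^esub> y \<in> N +>\<^bsub>M\<^esub> (a \<odot>\<^bsub>M\<^esub> x)"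
        using closed z \<open>a \<in> carrier R\<close> by (auto simp: a_r_coset_def r_coset_def)
      then show ?thesis
        using \<open>a \<in> carrier R\<close> \<open>x \<in> carrier M\<close> N.a_subgroup
        by (metis a_repr_independence smult_closed)
    qed
    have "N +>\<^bsub>M\<^esub> x \<noteq> {}"
      using that N.a_rcos_self by blast
    moreover have "(\<Union>y\<in>N +>\<^bsub>M\<^esub> x. N +>\<^bsub>M\<^esub> (a \<odot>\<^bsub>M\<^esub> y)) = (\<Union>y\<in>N +>\<^bsub>M\<^esub> x. N +>\<^bsub>M\<^esub> (a \<odot>\<^bsub>M\<^esub> x))"
      by (rule SUP_cong [OF refl const])
    ultimately show ?thesis
      by (simp add: quotient_module_def)
  qed
  have add: "(N +>\<^bsub>M\<^esub> x) \<oplus>\<^bsub>?Q\<^esub> (N +>\<^bsub>M\<^esub> y) = N +>\<^bsub>M\<^esub> (x \<oplus>\<^bsub>M\<^esub> y)"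
    if "x \<in> carrier M" "y \<in> carrier M" for x y
    using N.a_rcos_sum [OF that] by (simp add: quotient_module_def)
  have carI: "N +>\<^bsub>M\<^esub> x \<in> carrier ?Q" if "x \<in> carrier M" for x
    using that a_rcosetsI N.a_subset by (simp add: quotient_module_def)
  have carE: "\<exists>x\<in>carrier M. C = N +>\<^bsub>M\<^esub> x" if "C \<in> carrier ?Q" for C
    using that by (auto simp: quotient_module_def A_RCOSETS_def')
  have zero: "zero ?Q = N +>\<^bsub>M\<^esub> \<zero>\<^bsub>M\<^esub>"
    using a_coset_add_zero [OF N.a_subset] by (simp add: quotient_module_def)
  have ab: "abelian_group ?Q"
  proof (rule abelian_groupI)
    fix C assume "C \<in> carrier ?Q"
    then obtain x where "x \<in> carrier M" "C = N +>\<^bsub>M\<^esub> x" using carE by blast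
    then show "\<exists>D\<in>carrier ?Q. D \<oplus>\<^bsub>?Q\<^esub> C = \<zero>\<^bsub>?Q\<^esub>"
      by (intro bexI [where x = "N +>\<^bsub>M\<^esub> (\<ominus>\<^bsub>M\<^esub> x)"]) (simp_all add: add zero carI l_neg)
  next
    fix C D assume "C \<in> carrier ?Q" "D \<in> carrier ?Q"
    then obtain x y where "x \<in> carrier M" "C = N +>\<^bsub>M\<^esub> x" "y \<in> carrier M" "D = N +>\<^bsub>M\<^esub> y"
      using carE by metis
    then show "C \<oplus>\<^bsub>?Q\<^esub> D = D \<oplus>\<^bsub>?Q\<^esub> C" "C \<oplus>\<^bsub>?Q\<^esub> D \<in> carrier ?Q"
      by (simp_all add: add carI a_comm)
  next
    fix C assume "C \<in> carrier ?Q"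
    then obtain x where "x \<in> carrier M" "C = N +>\<^bsub>M\<^esub> x" using carE by blast
    then show "\<zero>\<^bsub>?Q\<^esub> \<oplus>\<^bsub>?Q\<^esub> C = C" by (simp add: add zero)
  next
    fix C D E assume "C \<in> carrier ?Q" "D \<in> carrier ?Q" "E \<in> carrier ?Q"
    then obtain x y z where "x \<in> carrier M" "C = N +>\<^bsub>M\<^esub> x" "y \<in> carrier M" "D = N +>\<^bsub>M\<^esub> y"
      "z \<in> carrier M" "E = N +>\<^bsub>M\<^esub> z"
      using carE by metis
    then show "C \<oplus>\<^bsub>?Q\<^esub> D \<oplus>\<^bsub>?Q\<^esub> E = C \<oplus>\<^bsub>?Q\<^esub> (D \<oplus>\<^bsub>?Q\<^esub> E)"
      by (simp add: add a_assoc)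
  qed (simp add: zero carI)
  show ?thesis
  proof (rule moduleI)
    fix a b C assume a: "a \<in> carrier R" "b \<in> carrier R" and "C \<in> carrier ?Q"
    then obtain x where "x \<in> carrier M" "C = N +>\<^bsub>M\<^esub> x" using carE by blast
    with a show "(a \<oplus>\<^bsub>R\<^esub> b) \<odot>\<^bsub>?Q\<^esub> C = a \<odot>\<^bsub>?Q\<^esub> C \<oplus>\<^bsub>?Q\<^esub> b \<odot>\<^bsub>?Q\<^esub> C"
      "(a \<otimes>\<^bsub>R\<^esub> b) \<odot>\<^bsub>?Q\<^esub> C = a \<odot>\<^bsub>?Q\<^esub> (b \<odot>\<^bsub>?Q\<^esub> C)" "a \<odot>\<^bsub>?Q\<^esub> C \<in> carrier ?Q"
      by (simp_all add: add smult smult_l_distr smult_assoc1 carI)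
  next
    fix a C D assume a: "a \<in> carrier R" and "C \<in> carrier ?Q" "D \<in> carrier ?Q"
    then obtain x y where "x \<in> carrier M" "C = N +>\<^bsub>M\<^esub> x" "y \<in> carrier M" "D = N +>\<^bsub>M\<^esub> y"
      using carE by metis
    with a show "a \<odot>\<^bsub>?Q\<^esub> (C \<oplus>\<^bsub>?Q\<^esub> D) = a \<odot>\<^bsub>?Q\<^esub> C \<oplus>\<^bsub>?Q\<^esub> a \<odot>\<^bsub>?Q\<^esub> D"
      by (simp add: add smult smult_r_distr)
  next
    fix C assume "C \<in> carrier ?Q"
    then obtain x where "x \<in> carrier M" "C = N +>\<^bsub>M\<^esub> x" using carE by blast
    then show "\<one>\<^bsub>R\<^esub> \<odot>\<^bsub>?Q\<^esub> C = C" by (simp add: smult)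
  qed (fact R.is_cring ab)+
qed

theorem vectorspace_homology_space:
  "vectorspace class_ring (homology_space p X :: ('k::field, ('a, 'k) kchain set) module)"
  using module_quotient_module [OF vectorspace.axioms(1) [OF vectorspace_kcycle_space]
      submodule_kboundaries]
  by (simp add: homology_space_def vectorspace_def class_field)


subsection \<open>Betti numbers and the Poincare polynomial\<close>

definition betti_number :: "'k::field itself \<Rightarrow> 'a topology \<Rightarrow> nat \<Rightarrow> enat" where
  "betti_number _ X p =
     (let H = homology_space p X :: ('k, ('a, 'k) kchain set) module in
      if vectorspace.fin_dim class_ring H then enat (vectorspace.dim class_ring H) else \<infinity>)"

text \<open>Meaningful only if all Betti numbers are finite and almost all of them vanish.\<close>

definition poincare_poly :: "'k::field itself \<Rightarrow> 'a topology \<Rightarrow> int poly" where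
  "poincare_poly k X = Abs_poly (\<lambda>i. int (the_enat (betti_number k X i)))"

definition coeffwise_le :: "int poly \<Rightarrow> int poly \<Rightarrow> bool" where
  "coeffwise_le P Q \<longleftrightarrow> (\<forall>i. coeff P i \<le> coeff Q i)"

end

theory Submission
  imports Defs
begin

text \<open>Adding one contractible open set \<open>V\<close> to a union \<open>A\<close> of \<open>m\<close> members of a good cover, the
  intersection \<open>A \<inter> V\<close> is again covered by \<open>m\<close> sets with contractible or empty intersections.
  Exactness of the reduced Mayer--Vietoris sequence bounds the rank of reduced homology of \<open>A \<union> V\<close>
  in degree \<open>p\<close> by that of \<open>A\<close> in degree \<open>p\<close> plus that of \<open>A \<inter> V\<close> in degree \<open>p - 1\<close>, and
  Pascal's rule gives the bound \<open>m choose (p + 1)\<close> for a good cover by \<open>m + 1\<close> sets. Homotopy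
  invariance carries the bound from the space with the good cover to \<open>X\<close>.

  Homology over a field is reduced to the integral theory: an operator from simplices to integral
  chains extends linearly to chains over the field, so subdivision and the prism operator, together
  with the chain homotopies they satisfy, carry over.\<close>

section \<open>Extension of integral operators to chains over a field\<close>

definition kext :: "('x \<Rightarrow> 'y \<Rightarrow>\<^sub>0 int) \<Rightarrow> ('x \<Rightarrow>\<^sub>0 'k) \<Rightarrow> 'y \<Rightarrow>\<^sub>0 'k::field" where
  "kext T c = (\<Sum>f\<in>Poly_Mapping.keys c.
     Poly_Mapping.map (\<lambda>m. of_int m * Poly_Mapping.lookup c f) (T f))"

abbreviation ksmult :: "'k::field \<Rightarrow> ('x \<Rightarrow>\<^sub>0 'k) \<Rightarrow> 'x \<Rightarrow>\<^sub>0 'k" where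
  "ksmult a \<equiv> Poly_Mapping.map ((*) a)"

lemma lookup_kext:
  "Poly_Mapping.lookup (kext T c) g =
     (\<Sum>f\<in>Poly_Mapping.keys c. of_int (Poly_Mapping.lookup (T f) g) * Poly_Mapping.lookup c f)"
  unfolding kext_def lookup_sum
  by (rule sum.cong) (auto simp: Poly_Mapping.map.rep_eq when_def)

lemma lookup_kext_superset:
  assumes "finite K" "Poly_Mapping.keys c \<subseteq> K"
  shows "Poly_Mapping.lookup (kext T c) g =
     (\<Sum>f\<in>K. of_int (Poly_Mapping.lookup (T f) g) * Poly_Mapping.lookup c f)"
  unfolding lookup_kext using assms by (intro sum.mono_neutral_left) (auto simp: in_keys_iff)

lemma kext_0 [simp]: "kext T 0 = 0"
  by (simp add: kext_def)

lemma kext_add: "kext T (c + d) = kext T c + kext T d"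
proof (rule poly_mapping_eqI)
  fix g
  let ?K = "Poly_Mapping.keys c \<union> Poly_Mapping.keys d"
  show "Poly_Mapping.lookup (kext T (c + d)) g = Poly_Mapping.lookup (kext T c + kext T d) g"
    unfolding lookup_add
    by (subst (1 2 3) lookup_kext_superset [of ?K])
      (use Poly_Mapping.keys_add [of c d] in \<open>auto simp: lookup_add sum.distrib distrib_left\<close>)
qed

lemma kext_ksmult: "kext T (ksmult a c) = ksmult a (kext T c)"
proof (rule poly_mapping_eqI)
  fix g
  have "Poly_Mapping.keys (ksmult a c) \<subseteq> Poly_Mapping.keys c"
    by (auto simp: in_keys_iff lookup_smult)
  then show "Poly_Mapping.lookup (kext T (ksmult a c)) g = Poly_Mapping.lookup (ksmult a (kext T c)) g"
    unfolding lookup_smult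
    by (subst (1 2) lookup_kext_superset [of "Poly_Mapping.keys c"])
      (auto simp: lookup_smult sum_distrib_left mult_ac)
qed

lemma kext_diff: "kext T (c - d) = kext T c - kext T d"
  using kext_add [of T "c - d" d] by simp

lemma kext_cong:
  "(\<And>f. f \<in> Poly_Mapping.keys c \<Longrightarrow> S f = T f) \<Longrightarrow> kext S c = kext T c"
  by (simp add: kext_def)

lemma kext_plus: "kext (\<lambda>f. S f + T f) c = kext S c + kext T c"
  by (rule poly_mapping_eqI) (simp add: lookup_kext lookup_add sum.distrib distrib_right)

lemma kext_minus: "kext (\<lambda>f. S f - T f) c = kext S c - kext T c"
  by (rule poly_mapping_eqI) (simp add: lookup_kext lookup_minus sum_subtractf left_diff_distrib)

lemma kext_frag_of [simp]: "kext frag_of c = c"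
  by (rule poly_mapping_eqI)
    (auto simp: lookup_kext lookup_single when_def if_distrib [of of_int] sum.delta
      if_distrib [of "\<lambda>x. x * _"] in_keys_iff cong: if_cong)

lemma keys_kext: "Poly_Mapping.keys (kext T c) \<subseteq> (\<Union>f\<in>Poly_Mapping.keys c. Poly_Mapping.keys (T f))"
proof
  fix g assume "g \<in> Poly_Mapping.keys (kext T c)"
  then have "(\<Sum>f\<in>Poly_Mapping.keys c.
       of_int (Poly_Mapping.lookup (T f) g) * Poly_Mapping.lookup c f) \<noteq> 0"
    by (simp add: in_keys_iff lookup_kext)
  then obtain f where "f \<in> Poly_Mapping.keys c"
    "of_int (Poly_Mapping.lookup (T f) g) * Poly_Mapping.lookup c f \<noteq> 0"
    by (rule sum.not_neutral_contains_not_neutral)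
  then show "g \<in> (\<Union>f\<in>Poly_Mapping.keys c. Poly_Mapping.keys (T f))"
    by (intro UN_I [of f]) (auto simp: in_keys_iff)
qed

lemma kext_kext: "kext S (kext T c) = kext (\<lambda>f. frag_extend S (T f)) c"
proof (rule poly_mapping_eqI)
  fix h
  \<comment> \<open>\<open>K\<close> collects the simplices of every \<open>T f\<close>, including
    those that cancel in \<open>kext T c\<close>. Both sides thus become sums over the same finite
    set, and the order of summation can be exchanged.\<close>
  define K where "K = (\<Union>f\<in>Poly_Mapping.keys c. Poly_Mapping.keys (T f))"
  have K: "finite K" "Poly_Mapping.keys (kext T c) \<subseteq> K"
    unfolding K_def using keys_kext [of T c] by auto
  have ext: "Poly_Mapping.lookup (frag_extend S (T f)) h =
       (\<Sum>g\<in>K. Poly_Mapping.lookup (T f) g * Poly_Mapping.lookup (S g) h)"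
    if "f \<in> Poly_Mapping.keys c" for f
    unfolding frag_extend_def lookup_sum
    using that K(1) by (simp, intro sum.mono_neutral_left) (auto simp: K_def in_keys_iff)
  show "Poly_Mapping.lookup (kext S (kext T c)) h
      = Poly_Mapping.lookup (kext (\<lambda>f. frag_extend S (T f)) c) h"
    unfolding lookup_kext_superset [OF K]
    by (simp add: lookup_kext ext sum_distrib_left sum_distrib_right)
      (subst sum.swap, simp add: mult_ac)
qed

text \<open>This is the bridge to the integral theory: the boundary over the field is itself the
  extension of an integral operator, so integral identities checked on one simplex transfer.\<close>

lemma kchain_boundary_eq_kext: "kchain_boundary p c = kext (\<lambda>f. chain_boundary p (frag_of f)) c"
proof (rule poly_mapping_eqI)
  fix g
  show "Poly_Mapping.lookup (kchain_boundary p c) g =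
        Poly_Mapping.lookup (kext (\<lambda>f. chain_boundary p (frag_of f)) c) g"
    by (auto simp: kchain_boundary_def lookup_kext chain_boundary_def lookup_sum lookup_single
        sum_distrib_right when_def intro!: sum.cong)
qed

lemma singular_kchain_kext:
  assumes "\<And>f. f \<in> Poly_Mapping.keys c \<Longrightarrow> singular_chain p X (T f)"
  shows "singular_kchain p X (kext T c)"
  using assms keys_kext [of T c] unfolding singular_kchain_def singular_chain_def by blast

lemma singular_kchain_diff:
  "singular_kchain p X c \<Longrightarrow> singular_kchain p X d \<Longrightarrow> singular_kchain p X (c - d)"
  unfolding singular_kchain_def using Poly_Mapping.keys_diff [of c d] by blast

lemma kchain_boundary_diff:
  "kchain_boundary p (c - d) = kchain_boundary p c - kchain_boundary p d"
  by (simp add: kchain_boundary_eq_kext kext_diff)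

lemma singular_kchain_mono:
  "singular_kchain p (subtopology X S) c \<Longrightarrow> S \<subseteq> T \<Longrightarrow> singular_kchain p (subtopology X T) c"
  unfolding singular_kchain_def using singular_simplex_mono by blast

text \<open>A homomorphism on a free abelian group is determined by its values on generators.
  Through this, the \<open>frag_extend\<close> that \<open>kext_kext\<close> produces is recognised
  as the original operator.\<close>

lemma frag_extend_additive:
  assumes "\<And>a b. T (a - b) = T a - T b"
  shows "frag_extend (\<lambda>f. T (frag_of f)) c = T c"
proof -
  have "T 0 = 0" using assms [of 0 0] by simp
  then show ?thesis
    by (induction c rule: frag_induction [OF subset_UNIV]) (auto simp: assms frag_extend_diff)
qed

lemma chain_boundary_frag_extend:
  "frag_extend (\<lambda>f. chain_boundary p (frag_of f)) c = chain_boundary p c"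
  by (rule frag_extend_additive) (rule chain_boundary_diff)

text \<open>The operator \<open>E\<close>, the homotopy one degree lower, is applied to the boundary
  of the cycle \<open>z\<close> and so contributes nothing. What remains of the homotopy is the
  boundary of \<open>kext D z\<close>.\<close>

lemma kext_chain_homotopy:
  fixes z :: "('a, 'k::field) kchain"
  assumes z: "z \<in> kcycles p X"
    and D: "\<And>f. singular_simplex p X f \<Longrightarrow> singular_chain (Suc p) Y (D f)"
    and eq: "\<And>f. singular_simplex p X f \<Longrightarrow>
       chain_boundary (Suc p) (D f) + frag_extend E (chain_boundary p (frag_of f)) = F f - G f"
  shows "kext F z - kext G z \<in> kboundaries p Y"
proof -
  have keys: "singular_simplex p X f" if "f \<in> Poly_Mapping.keys z" for f
    using z that by (auto simp: kcycles_def singular_kchain_def)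
  have "kext F z - kext G z
      = kext (\<lambda>f. chain_boundary (Suc p) (D f) + frag_extend E (chain_boundary p (frag_of f))) z"
    unfolding kext_minus [symmetric] by (rule kext_cong) (simp add: eq keys)
  also have "\<dots> = kchain_boundary (Suc p) (kext D z) + kext E (kchain_boundary p z)"
    by (simp add: kext_plus kchain_boundary_eq_kext kext_kext chain_boundary_frag_extend)
  also have "kchain_boundary p z = 0"
    using z by (simp add: kcycles_def)
  finally show ?thesis
    unfolding kboundaries_def using D keys by (auto intro!: image_eqI singular_kchain_kext)
qed

section \<open>Push-forward of chains along maps\<close>

definition kchain_map :: "nat \<Rightarrow> ('a \<Rightarrow> 'b) \<Rightarrow> ('a, 'k::field) kchain \<Rightarrow> ('b, 'k) kchain" where
  "kchain_map p g = kext (\<lambda>f. frag_of (simplex_map p g f))"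

lemma kchain_map_add: "kchain_map p g (c + d) = kchain_map p g c + kchain_map p g d"
  by (simp add: kchain_map_def kext_add)

lemma kchain_map_diff: "kchain_map p g (c - d) = kchain_map p g c - kchain_map p g d"
  by (simp add: kchain_map_def kext_diff)

lemma kchain_map_0 [simp]: "kchain_map p g 0 = 0"
  by (simp add: kchain_map_def)

lemma kchain_map_ksmult: "kchain_map p g (ksmult a c) = ksmult a (kchain_map p g c)"
  by (simp add: kchain_map_def kext_ksmult)

lemma singular_kchain_kchain_map:
  assumes "singular_kchain p X c" "continuous_map X Y g"
  shows "singular_kchain p Y (kchain_map p g c)"
  unfolding kchain_map_def using assms
  by (intro singular_kchain_kext)
    (auto simp: singular_kchain_def singular_chain_of intro: singular_simplex_simplex_map)

lemma kchain_map_compose: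
  "kchain_map p g (kchain_map p f c) = kchain_map p (g \<circ> f) c"
proof -
  have "simplex_map p g (simplex_map p f s) = simplex_map p (g \<circ> f) s" for s
    by (auto simp: simplex_map_def)
  then show ?thesis
    by (simp add: kchain_map_def kext_kext)
qed

lemma kchain_boundary_kchain_map:
  assumes "singular_kchain p X c"
  shows "kchain_boundary p (kchain_map p g c) = kchain_map (p - 1) g (kchain_boundary p c)"
proof -
  have "kchain_boundary p (kchain_map p g c)
      = kext (\<lambda>f. chain_boundary p (chain_map p g (frag_of f))) c"
    by (simp add: kchain_map_def kchain_boundary_eq_kext kext_kext)
  also have "\<dots> = kext (\<lambda>f. chain_map (p - 1) g (chain_boundary p (frag_of f))) c"
    using assms
    by (intro kext_cong chain_boundary_chain_map [unfolded One_nat_def [symmetric]])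
      (auto simp: singular_kchain_def singular_chain_of)
  also have "\<dots> = kchain_map (p - 1) g (kchain_boundary p c)"
    by (simp add: kchain_map_def kchain_boundary_eq_kext kext_kext chain_map_def o_def)
  finally show ?thesis .
qed

lemma kchain_map_ident:
  assumes "singular_kchain p X c" "\<And>x. x \<in> topspace X \<Longrightarrow> f x = x"
  shows "kchain_map p f c = c"
proof -
  have "kchain_map p f c = kext frag_of c"
    unfolding kchain_map_def using assms
    by (intro kext_cong arg_cong [where f = frag_of] simplex_map_id_gen) (auto simp: singular_kchain_def)
  then show ?thesis by simp
qed

lemma kchain_map_kcycles:
  assumes "c \<in> kcycles p X" "continuous_map X Y g"
  shows "kchain_map p g c \<in> kcycles p Y"
  using assms by (auto simp: kcycles_def singular_kchain_kchain_map kchain_boundary_kchain_map)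

lemma kchain_map_kboundaries:
  assumes "c \<in> kboundaries p X" "continuous_map X Y g"
  shows "kchain_map p g c \<in> kboundaries p Y"
proof -
  obtain d where d: "singular_kchain (Suc p) X d" "c = kchain_boundary (Suc p) d"
    using assms(1) by (auto simp: kboundaries_def)
  then have "kchain_map p g c = kchain_boundary (Suc p) (kchain_map (Suc p) g d)"
    using kchain_boundary_kchain_map [OF d(1), of g] by simp
  then show ?thesis
    using d assms(2) unfolding kboundaries_def by (auto intro!: singular_kchain_kchain_map)
qed


section \<open>Homotopy invariance\<close>

text \<open>A contraction makes \<open>z\<close> homologous to its push-forward to a point
  \<open>a\<close>. In positive degree cycles over a point bound. In degree 0 the push-forward
  factors through the type \<open>unit\<close>, where it vanishes by \<open>aug\<close>, which says
  that the coefficients of \<open>z\<close> sum to zero.\<close>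

lemma singular_relboundary_contractible:
  assumes "contractible_space M" and z: "singular_relcycle p M {} z"
    and aug: "p = 0 \<Longrightarrow> chain_map 0 (\<lambda>_. ()) z = 0"
  shows "singular_relboundary p M {} z"
proof (cases "topspace M = {}")
  case True
  then have "z = 0"
    using z singular_chain_empty [of M p z] by (simp add: singular_cycle)
  then show ?thesis by simp
next
  case False
  obtain a where a: "homotopic_with (\<lambda>_. True) M M id (\<lambda>x. a)"
    using assms(1) by (auto simp: contractible_space_def)
  then have cont: "continuous_map M M (\<lambda>x. a)"
    using homotopic_with_imp_continuous_maps by blast
  then have aM: "a \<in> topspace M"
    using False by (auto simp: continuous_map_def)
  have "homologous_rel p M {} (chain_map p id z) (chain_map p (\<lambda>x. a) z)"
    using a z by (intro homotopic_imp_homologous_rel_chain_maps) auto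
  moreover have "chain_map p id z = z"
    using z by (intro chain_map_ident) (auto simp: singular_cycle)
  moreover have "singular_relboundary p M {} (chain_map p (\<lambda>x. a) z)"
  proof (cases "p = 0")
    case True
    have "chain_map p (\<lambda>x. a) z = chain_map p ((\<lambda>_. a) \<circ> (\<lambda>_. ())) z"
      by (simp add: o_def)
    also have "\<dots> = 0"
      using aug True by (simp only: chain_map_compose) simp
    finally show ?thesis by simp
  next
    case False
    have "singular_relcycle p (subtopology M {a}) {} (chain_map p (\<lambda>x. a) z)"
      using cont by (intro singular_relcycle_chain_map [OF z]) (auto simp: continuous_map_in_subtopology)
    then have "singular_relboundary p (subtopology M {a}) {} (chain_map p (\<lambda>x. a) z)"
      using False aM by (subst singular_boundary_eq_cycle_singleton [of _ a]) auto
    then show ?thesis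
      using aM singular_boundary_mono [of "{a}" "topspace M" p M] by simp
  qed
  ultimately show ?thesis
    unfolding homologous_rel_def using singular_relboundary_add by fastforce
qed

text \<open>By convexity, the straight-line homotopy \<open>h\<close> to the zeroth vertex
  \<open>v\<close> stays in the simplex.\<close>

lemma contractible_space_standard_simplex:
  "contractible_space (subtopology (powertop_real UNIV) (standard_simplex p))"
proof -
  let ?D = "subtopology (powertop_real UNIV) (standard_simplex p)"
  let ?I = "top_of_set {0..1::real}"
  define v :: "nat \<Rightarrow> real" where "v = (\<lambda>j. if j = 0 then 1 else 0)"
  have v: "v \<in> standard_simplex p"
    by (simp add: v_def)
  define h where "h = (\<lambda>(t, x) i. (1 - t) * x i + t * v i)"
  have fst: "continuous_map (prod_topology ?I ?D) euclideanreal fst"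
    using continuous_map_fst continuous_map_into_fulltopology by blast
  have "continuous_map (prod_topology ?I ?D) (powertop_real UNIV) snd"
    using continuous_map_snd continuous_map_into_fulltopology by blast
  then have snd: "continuous_map (prod_topology ?I ?D) euclideanreal (\<lambda>z. snd z i)" for i
    by (simp add: continuous_map_componentwise_UNIV)
  have "continuous_map (prod_topology ?I ?D) (powertop_real UNIV) h"
    unfolding continuous_map_componentwise_UNIV h_def case_prod_beta
    by (intro allI continuous_map_add continuous_map_real_mult continuous_map_diff fst snd) auto
  then have "continuous_map (prod_topology ?I ?D) ?D h"
    using convex_standard_simplex [OF _ v]
    by (auto simp: continuous_map_in_subtopology h_def)
  then show ?thesis
    unfolding contractible_space_def homotopic_with_def
    by (intro exI [of _ v] exI [of _ h]) (auto simp: h_def)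
qed

section \<open>The prism operator by acyclic models\<close>

definition prism_model :: "nat \<Rightarrow> (real \<times> (nat \<Rightarrow> real)) topology" where
  "prism_model p =
     prod_topology (top_of_set {0..1}) (subtopology (powertop_real UNIV) (standard_simplex p))"

text \<open>The universal simplex: \<open>f\<close> maps it to the chain of \<open>f\<close> itself,
  for every singular simplex \<open>f\<close>. The restriction is there because singular simplices
  are extensional functions on the standard simplex.\<close>

definition iota :: "nat \<Rightarrow> (nat \<Rightarrow> real) chain" where
  "iota p = frag_of (restrict id (standard_simplex p))"

text \<open>The chain \<open>d\<close> in the cylinder over the standard simplex prescribes the
  operator everywhere: \<open>apsnd f\<close> is the product of the identity of the interval with
  \<open>f\<close>.\<close>

definition prism :: "(real \<times> (nat \<Rightarrow> real)) chain \<Rightarrow> nat \<Rightarrow> 'a chain \<Rightarrow> (real \<times> 'a) chain" where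
  "prism d q c = frag_extend (\<lambda>f. chain_map (Suc q) (apsnd f) d) c"

lemma topspace_prism_model: "topspace (prism_model p) = {0..1} \<times> standard_simplex p"
  by (simp add: prism_model_def)

lemma contractible_space_prism_model: "contractible_space (prism_model p)"
proof -
  have "contractible_space (top_of_set {0..1::real})"
    unfolding contractible_space_top_of_set by (intro convex_imp_contractible convex_real_interval)
  then show ?thesis
    unfolding prism_model_def contractible_space_prod_topology
    using contractible_space_standard_simplex by blast
qed

lemma singular_chain_iota:
  "singular_chain p (subtopology (powertop_real UNIV) (standard_simplex p)) (iota p)"
  by (simp add: iota_def singular_chain_of simplicial_imp_singular_simplex)

lemma prism_0 [simp]: "prism d q 0 = 0"
  by (simp add: prism_def)

lemma prism_diff: "prism d q (a - b) = prism d q a - prism d q b"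
  by (simp add: prism_def frag_extend_diff)

lemma continuous_map_prism_model:
  assumes "singular_simplex q X f"
  shows "continuous_map (prism_model q) (prod_topology (top_of_set {0..1}) X) (apsnd f)"
  using assms unfolding prism_model_def apsnd_def map_prod_def
  by (simp add: continuous_map_prod_top singular_simplex_def)

lemma singular_chain_prism:
  assumes "singular_chain (Suc q) (prism_model q) d" "singular_chain q X c"
  shows "singular_chain (Suc q) (prod_topology (top_of_set {0..1}) X) (prism d q c)"
  unfolding prism_def using assms
  by (intro singular_chain_extend singular_chain_chain_map [OF assms(1)] continuous_map_prism_model)
    (auto simp: singular_chain_def)

lemma chain_map_prism:
  assumes d: "singular_chain (Suc q) (prism_model q) d" and c: "singular_chain q X c"
  shows "chain_map (Suc q) (apsnd g) (prism d q c) = prism d q (chain_map q g c)"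
  using c unfolding singular_chain_def
proof (induction c rule: frag_induction)
  case (one f)
  have "chain_map (Suc q) (apsnd g) (chain_map (Suc q) (apsnd f) d)
      = chain_map (Suc q) (apsnd g \<circ> apsnd f) d"
    by (simp add: chain_map_compose)
  \<comment> \<open>\<open>simplex_map\<close> restricts its result to the standard simplex, so the
    two maps are compared only on the model, which contains the simplices of
    \<open>d\<close>.\<close>
  also have "\<dots> = chain_map (Suc q) (apsnd (simplex_map q g f)) d"
    by (rule chain_map_eq [OF d]) (auto simp: topspace_prism_model simplex_map_def)
  finally show ?case
    by (simp add: prism_def)
qed (auto simp: prism_diff chain_map_diff)

text \<open>By naturality, the prism identity for the universal simplex, which is \<open>bd\<close>,
  is carried by \<open>apsnd f\<close> to every simplex \<open>f\<close> and then extends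
  additively. For \<open>q = 0\<close> the boundary of \<open>c\<close> is zero and the last term
  drops out.\<close>

lemma chain_boundary_prism:
  assumes d: "singular_chain (Suc q) (prism_model q) d"
    and d': "singular_chain (Suc (q - 1)) (prism_model (q - 1)) d'"
    and bd: "chain_boundary (Suc q) d = chain_map q (Pair 1) (iota q) - chain_map q (Pair 0) (iota q)
               - prism d' (q - 1) (chain_boundary q (iota q))"
    and c: "singular_chain q X c"
  shows "chain_boundary (Suc q) (prism d q c)
       = chain_map q (Pair 1) c - chain_map q (Pair 0) c - prism d' (q - 1) (chain_boundary q c)"
  using c unfolding singular_chain_def
proof (induction c rule: frag_induction)
  case (one f)
  then have f: "singular_simplex q X f" by simp
  have pt: "chain_map q (apsnd f) (chain_map q (Pair t) (iota q)) = chain_map q (Pair t) (frag_of f)"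
    for t :: real
  proof -
    have "apsnd f \<circ> Pair t = Pair t \<circ> f" by auto
    then have "chain_map q (apsnd f) (chain_map q (Pair t) (iota q))
             = chain_map q (Pair t) (chain_map q f (iota q))"
      using chain_map_compose [of q "apsnd f" "Pair t", THEN fun_cong, of "iota q"]
        chain_map_compose [of q "Pair t" f, THEN fun_cong, of "iota q"]
      by (simp only: comp_apply)
    then show ?thesis
      by (simp add: singular_simplex_chain_map_id [OF f, folded iota_def] del: chain_map_of)
  qed
  have "chain_map q (apsnd f) (prism d' (q - 1) (chain_boundary q (iota q)))
      = prism d' (q - 1) (chain_boundary q (frag_of f))"
  proof (cases q)
    case 0
    then show ?thesis by (simp add: chain_boundary_def)
  next
    case (Suc m)
    have "chain_map q (apsnd f) (prism d' (q - 1) (chain_boundary q (iota q)))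
        = prism d' m (chain_map m f (chain_boundary q (iota q)))"
      using chain_map_prism [of m d' "subtopology (powertop_real UNIV) (standard_simplex q)"
          "chain_boundary q (iota q)" f] d' singular_chain_boundary [OF singular_chain_iota [of q]] Suc
      by simp
    also have "chain_map m f (chain_boundary q (iota q)) = chain_boundary q (chain_map q f (iota q))"
      using chain_boundary_chain_map [OF singular_chain_iota, of q f] Suc by simp
    also have "chain_map q f (iota q) = frag_of f"
      by (rule singular_simplex_chain_map_id [OF f, folded iota_def])
    finally show ?thesis
      by (simp add: Suc)
  qed
  then show ?case
    using pt [of 1] pt [of 0] chain_boundary_chain_map [OF d, of "apsnd f"]
    by (simp add: prism_def [of d] bd chain_map_diff del: chain_map_of)
qed (auto simp: prism_diff chain_boundary_diff chain_map_diff)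

text \<open>The chains below are found one degree at a time by the method of acyclic models: each prescribed
  boundary is a cycle in a contractible space.\<close>

lemma ex_prism_chains:
  obtains d where "\<And>q. singular_chain (Suc q) (prism_model q) (d q)"
    and "\<And>q. chain_boundary (Suc q) (d q) = chain_map q (Pair 1) (iota q) - chain_map q (Pair 0) (iota q)
           - prism (d (q - 1)) (q - 1) (chain_boundary q (iota q))"
proof -
  define bd where "bd q d d' \<longleftrightarrow> chain_boundary (Suc q) d =
      chain_map q (Pair 1) (iota q) - chain_map q (Pair 0) (iota q)
           - prism d' (q - 1) (chain_boundary q (iota q))" for q d d'
  \<comment> \<open>\<open>good\<close> remembers some predecessor \<open>d'\<close>, so that the
    boundary of \<open>d\<close> is known at the next stage, where the newly prescribed boundary has
    to be a cycle.\<close>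
  define good where "good q d \<longleftrightarrow> singular_chain (Suc q) (prism_model q) d \<and>
      (\<exists>d'. singular_chain (Suc (q - 1)) (prism_model (q - 1)) d' \<and> bd q d d')" for q d
  let ?D = "\<lambda>p. subtopology (powertop_real UNIV) (standard_simplex p)"
  have step: "\<exists>d. singular_chain (Suc q) (prism_model q) d \<and> bd q d d'"
    if d': "singular_chain (Suc (q - 1)) (prism_model (q - 1)) d'" and q: "q = 0 \<or> good (q - 1) d'" for q d'
  proof -
    let ?r = "chain_map q (Pair 1) (iota q) - chain_map q (Pair 0) (iota q)
           - prism d' (q - 1) (chain_boundary q (iota q))"
    have pt: "singular_chain q (prism_model q) (chain_map q (Pair t) (iota q))" if "t \<in> {0..1}" for t
      using that unfolding prism_model_def
      by (intro singular_chain_chain_map [OF singular_chain_iota]) (auto simp: continuous_map_pairedI)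
    have bd_iota: "singular_chain (q - 1) (?D q) (chain_boundary q (iota q))"
      using singular_chain_boundary [OF singular_chain_iota [of q]] by simp
    have r: "singular_chain q (prism_model q) ?r"
    proof (cases q)
      case 0
      then show ?thesis
        using pt [of 0] pt [of 1] by (simp add: singular_chain_diff chain_boundary_def)
    next
      case (Suc m)
      then have "singular_chain q (prism_model q) (prism d' (q - 1) (chain_boundary q (iota q)))"
        using singular_chain_prism [OF d' bd_iota] by (simp add: prism_model_def)
      then show ?thesis
        using pt [of 0] pt [of 1] by (simp add: singular_chain_diff)
    qed
    \<comment> \<open>The prism identity one degree lower, applied to the boundary of
      \<open>iota q\<close>, cancels the contributions of the two ends; its remaining term contains
      a double boundary.\<close>
    have "chain_boundary q ?r = 0"
    proof (cases q)
      case 0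
      then show ?thesis by (simp add: chain_boundary_def)
    next
      case (Suc m)
      then have good: "good m d'" using q by simp
      then obtain d'' where d'': "singular_chain (Suc (m - 1)) (prism_model (m - 1)) d''" "bd m d' d''"
        by (auto simp: good_def)
      have "chain_boundary q (prism d' (q - 1) (chain_boundary q (iota q)))
         = chain_map m (Pair 1) (chain_boundary q (iota q)) - chain_map m (Pair 0) (chain_boundary q (iota q))
           - prism d'' (m - 1) (chain_boundary m (chain_boundary q (iota q)))"
        using chain_boundary_prism [of m d' d'' "?D q" "chain_boundary q (iota q)"] d' d'' bd_iota Suc
        by (simp add: bd_def)
      moreover have "chain_boundary m (chain_boundary q (iota q)) = 0"
        using chain_boundary_boundary_alt [of m "?D q" "iota q"] singular_chain_iota [of q] Suc by simp
      moreover have "chain_boundary q (chain_map q (Pair t) (iota q))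
          = chain_map m (Pair t) (chain_boundary q (iota q))" for t :: real
        using chain_boundary_chain_map [OF singular_chain_iota, of q "Pair t"] Suc by simp
      ultimately show ?thesis
        by (simp add: chain_boundary_diff del: chain_map_of)
    qed
    then have "singular_relcycle q (prism_model q) {} ?r"
      using r by (simp add: singular_cycle)
    \<comment> \<open>In degree 0 the cycle condition is empty. The two ends have coefficient sums 1
      and 1, so their difference is killed by the augmentation.\<close>
    moreover have "chain_map 0 (\<lambda>_. ()) ?r = 0" if "q = 0"
      using that by (simp add: chain_map_diff chain_boundary_def simplex_map_def iota_def)
    ultimately have "singular_relboundary q (prism_model q) {} ?r"
      using contractible_space_prism_model singular_relboundary_contractible by blast
    then show ?thesis
      unfolding bd_def by (auto simp: singular_boundary)
  qed
  have "\<exists>d. \<forall>q. good q (d q) \<and> bd (Suc q) (d (Suc q)) (d q)"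
  proof (rule dependent_nat_choice)
    show "\<exists>d. good 0 d"
      \<comment> \<open>Since \<open>0 - 1 = 0\<close>, a predecessor is formally required in degree
        0 too. The zero chain serves; its prism is taken of a boundary that vanishes.\<close>
      unfolding good_def using step [of 0 0] by fastforce
    show "\<exists>d'. good (Suc q) d' \<and> bd (Suc q) d' d" if "good q d" for d q
      using step [of "Suc q" d] that unfolding good_def by fastforce
  qed
  then obtain d where d: "\<And>q. good q (d q)" "\<And>q. bd (Suc q) (d (Suc q)) (d q)"
    by blast
  have "bd q (d q) (d (q - 1))" for q
  proof (cases q)
    case 0
    then show ?thesis
      using d(1) [of 0] by (auto simp: good_def bd_def chain_boundary_def)
  qed (use d(2) in auto)
  then show thesis
    using d(1) by (intro that [of d]) (auto simp: good_def bd_def)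
qed

text \<open>Composing the prism operator of the cylinder with the homotopy \<open>h\<close> yields
  the chain homotopy \<open>D\<close> from \<open>f\<close> to \<open>g\<close>.\<close>

theorem homotopic_imp_kchain_maps_homologous:
  fixes z :: "('a, 'k::field) kchain"
  assumes "homotopic_with (\<lambda>_. True) X Y f g" "z \<in> kcycles p X"
  shows "kchain_map p g z - kchain_map p f z \<in> kboundaries p Y"
proof -
  obtain h where h: "continuous_map (prod_topology (top_of_set {0..1::real}) X) Y h"
    "\<And>x. h (0, x) = f x" "\<And>x. h (1, x) = g x"
    using assms(1) unfolding homotopic_with_def by auto
  obtain d where d: "\<And>q. singular_chain (Suc q) (prism_model q) (d q)"
    "\<And>q. chain_boundary (Suc q) (d q) = chain_map q (Pair 1) (iota q) - chain_map q (Pair 0) (iota q)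
           - prism (d (q - 1)) (q - 1) (chain_boundary q (iota q))"
    using ex_prism_chains by blast
  define D where "D q c = chain_map (Suc q) h (prism (d q) q c)" for q and c :: "'a chain"
  have ends: "h \<circ> Pair 0 = f" "h \<circ> Pair 1 = g"
    using h by auto
  have extend: "frag_extend (\<lambda>s. D q (frag_of s)) c = D q c" for q c
    by (rule frag_extend_additive) (simp add: D_def prism_diff chain_map_diff)
  show ?thesis
    unfolding kchain_map_def
  proof (rule kext_chain_homotopy [OF assms(2)])
    fix s assume "singular_simplex p X s"
    then have s: "singular_chain p X (frag_of s)"
      by (simp add: singular_chain_of)
    note prism = singular_chain_prism [OF d(1) s]
    show "singular_chain (Suc p) Y (D p (frag_of s))"
      unfolding D_def by (rule singular_chain_chain_map [OF prism h(1)])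
    \<comment> \<open>By definition \<open>D (p - 1)\<close> pushes forward in degree
      \<open>Suc (p - 1)\<close>. This is \<open>p\<close> unless \<open>p = 0\<close>, and then
      both sides are zero.\<close>
    have D0: "D (p - 1) (chain_boundary p (frag_of s))
        = chain_map p h (prism (d (p - 1)) (p - 1) (chain_boundary p (frag_of s)))"
      by (cases p) (auto simp: D_def chain_boundary_def)
    have "chain_boundary (Suc p) (D p (frag_of s))
        = chain_map p h (chain_map p (Pair 1) (frag_of s) - chain_map p (Pair 0) (frag_of s)
           - prism (d (p - 1)) (p - 1) (chain_boundary p (frag_of s)))"
      unfolding D_def using chain_boundary_chain_map [OF prism, of h]
        chain_boundary_prism [OF d(1) d(1) d(2) s] by simp
    also have "\<dots> = chain_map p g (frag_of s) - chain_map p f (frag_of s)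
         - D (p - 1) (chain_boundary p (frag_of s))"
      using chain_map_compose [of p h "Pair 0", THEN fun_cong, of "frag_of s"]
        chain_map_compose [of p h "Pair 1", THEN fun_cong, of "frag_of s"] D0
      by (simp only: comp_apply chain_map_diff ends)
    finally show "chain_boundary (Suc p) (D p (frag_of s))
        + frag_extend (\<lambda>s. D (p - 1) (frag_of s)) (chain_boundary p (frag_of s))
        = frag_of (simplex_map p g s) - frag_of (simplex_map p f s)"
      by (simp add: extend)
  qed
qed


section \<open>Small chains\<close>

text \<open>Iterated subdivision replaces \<open>z\<close> by a homologous chain whose simplices
  each lie in \<open>A\<close> or in \<open>B\<close>, and such a chain can be sorted into two
  parts.\<close>

lemma kcycle_split:
  fixes z :: "('a, 'k::field) kchain"
  assumes z: "z \<in> kcycles p X" and AB: "openin X A" "openin X B" "topspace X \<subseteq> A \<union> B"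
  obtains x y where "singular_kchain p (subtopology X A) x" "singular_kchain p (subtopology X B) y"
    "x + y - z \<in> kboundaries p X"
proof -
  have keys: "singular_chain p X (frag_of f)" if "f \<in> Poly_Mapping.keys z" for f
    using z that by (auto simp: kcycles_def singular_kchain_def singular_chain_of)
  have "\<exists>n. \<forall>m\<ge>n. \<forall>s \<in> Poly_Mapping.keys ((singular_subdivision p ^^ m) (frag_of f)).
          \<exists>V\<in>{A, B}. s \<in> standard_simplex p \<rightarrow> V" if "f \<in> Poly_Mapping.keys z" for f
    by (rule sufficient_iterated_singular_subdivision_exists [of "{A, B}" X p "frag_of f"])
      (use AB keys [OF that] in auto)
  then obtain n where n: "\<And>f m s. \<lbrakk>f \<in> Poly_Mapping.keys z; n f \<le> m;
        s \<in> Poly_Mapping.keys ((singular_subdivision p ^^ m) (frag_of f))\<rbrakk>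
      \<Longrightarrow> \<exists>V\<in>{A, B}. s \<in> standard_simplex p \<rightarrow> V"
    by metis
  \<comment> \<open>One number of subdivisions for all of the finitely many simplices of
    \<open>z\<close>. It works because \<open>n f\<close> is a threshold and not an exact
    count.\<close>
  define N where "N = Max (n ` Poly_Mapping.keys z)"
  define F where "F f = (singular_subdivision p ^^ N) (frag_of f)" for f :: "(nat \<Rightarrow> real) \<Rightarrow> 'a"
  obtain h where h: "\<And>p. h p 0 = (0 :: 'a chain)"
        "\<And>p c1 c2. h p (c1-c2) = h p c1 - h p c2"
        "\<And>p X c. singular_chain p X c \<Longrightarrow> singular_chain (Suc p) X (h p c)"
        "\<And>p X c. singular_chain p X c
                 \<Longrightarrow> chain_boundary (Suc p) (h p c) + h (p - Suc 0) (chain_boundary p c)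
                   = (singular_subdivision p ^^ N) c - c"
    by (blast intro: chain_homotopic_iterated_singular_subdivision [of N])
  have hom: "kext F z - kext frag_of z \<in> kboundaries p X"
  proof (rule kext_chain_homotopy [OF z, where D = "\<lambda>f. h p (frag_of f)" and E = "\<lambda>f. h (p - 1) (frag_of f)"])
    fix f assume "singular_simplex p X f"
    then have f: "singular_chain p X (frag_of f)" by (simp add: singular_chain_of)
    show "singular_chain (Suc p) X (h p (frag_of f))" by (rule h(3) [OF f])
    show "chain_boundary (Suc p) (h p (frag_of f))
        + frag_extend (\<lambda>f. h (p - 1) (frag_of f)) (chain_boundary p (frag_of f)) = F f - frag_of f"
      using h(4) [OF f] by (simp add: frag_extend_additive h(2) F_def)
  qed
  have F_chain: "singular_chain p X (F f)" if "f \<in> Poly_Mapping.keys z" for f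
  proof -
    have "singular_chain p X ((singular_subdivision p ^^ m) (frag_of f))" for m
      by (induction m) (auto simp: keys [OF that] singular_chain_singular_subdivision)
    then show ?thesis by (simp add: F_def)
  qed
  have F_small: "\<exists>V\<in>{A, B}. s \<in> standard_simplex p \<rightarrow> V"
    if "f \<in> Poly_Mapping.keys z" "s \<in> Poly_Mapping.keys (F f)" for f s
    using that by (intro n [of f N]) (auto simp: F_def N_def)
  define z' where "z' = kext F z"
  have z': "singular_simplex p X s" "s \<in> standard_simplex p \<rightarrow> A \<or> s \<in> standard_simplex p \<rightarrow> B"
    if s: "s \<in> Poly_Mapping.keys z'" for s
  proof -
    obtain f where "f \<in> Poly_Mapping.keys z" "s \<in> Poly_Mapping.keys (F f)"
      using s keys_kext [of F z] unfolding z'_def by blast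
    then show "singular_simplex p X s" "s \<in> standard_simplex p \<rightarrow> A \<or> s \<in> standard_simplex p \<rightarrow> B"
      using F_chain F_small by (auto simp: singular_chain_def)
  qed
  \<comment> \<open>A simplex lying in both sets is assigned to \<open>A\<close>, so that it is
    counted only once in \<open>x + y\<close>.\<close>
  define x where "x = kext (\<lambda>s. if s \<in> standard_simplex p \<rightarrow> A then frag_of s else 0) z'"
  define y where "y = kext (\<lambda>s. if s \<in> standard_simplex p \<rightarrow> A then 0 else frag_of s) z'"
  have "x + y = kext frag_of z'"
    unfolding x_def y_def kext_plus [symmetric] by (rule kext_cong) simp
  moreover have "singular_kchain p (subtopology X A) x" "singular_kchain p (subtopology X B) y"
    unfolding x_def y_def using z'
    by (intro singular_kchain_kext; auto simp: singular_chain_of singular_simplex_subtopology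
        image_subset_iff_funcset)+
  ultimately show thesis
    using hom by (intro that) (auto simp: z'_def)
qed


section \<open>Ranks modulo boundaries\<close>

text \<open>Steinitz exchange modulo \<open>B\<close>. If \<open>s\<close> cannot be omitted, some
  \<open>x\<close> in \<open>K\<close> uses it; then \<open>x\<close> replaces \<open>s\<close>, and
  the induction continues with \<open>x\<close> absorbed into \<open>B\<close>. The outcome is a set
  of generators inside \<open>K\<close> that is no larger than the given one.\<close>

lemma (in vector_space) relative_generators_in_subspace:
  assumes "finite S" "subspace K" "B \<subseteq> K" "K \<subseteq> span (S \<union> B)"
  shows "\<exists>S'. finite S' \<and> card S' \<le> card S \<and> S' \<subseteq> K \<and> K \<subseteq> span (S' \<union> B)"
  using assms(1,3,4)
proof (induction S arbitrary: B rule: finite_induct)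
  case empty
  then have "K \<subseteq> span ({} \<union> B)" by simp
  then show ?case by (intro exI [of _ "{}"] conjI) simp_all
next
  case (insert s S)
  show ?case
  proof (cases "K \<subseteq> span (S \<union> B)")
    case True
    obtain S' where S': "finite S'" "card S' \<le> card S" "S' \<subseteq> K" "K \<subseteq> span (S' \<union> B)"
      using insert.IH [OF insert.prems(1) True] by (elim exE conjE)
    then have "card S' \<le> card (insert s S)"
      using insert.hyps by simp
    then show ?thesis
      using S' by (intro exI [of _ S'] conjI)
  next
    case False
    then obtain x where x: "x \<in> K" "x \<notin> span (S \<union> B)"
      by (meson subsetI)
    have "x \<in> span (insert s (S \<union> B))"
      using x(1) insert.prems(2) by (simp add: subset_iff)
    then have "s \<in> span (insert x (S \<union> B))"
      using x(2) by (rule in_span_insert)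
    then have "insert s S \<union> B \<subseteq> span (S \<union> insert x B)"
      using span_superset [of "insert x (S \<union> B)"] by simp
    then have "span (insert s S \<union> B) \<subseteq> span (S \<union> insert x B)"
      by (rule span_minimal [OF _ subspace_span])
    then have K: "K \<subseteq> span (S \<union> insert x B)"
      using insert.prems(2) by (rule order_trans [rotated])
    have "insert x B \<subseteq> K"
      using x(1) insert.prems(1) by simp
    obtain S' where S': "finite S'" "card S' \<le> card S" "S' \<subseteq> K" "K \<subseteq> span (S' \<union> insert x B)"
      using insert.IH [OF \<open>insert x B \<subseteq> K\<close> K] by (elim exE conjE)
    then have "card (insert x S') \<le> card (insert s S)"
      using insert.hyps card_insert_le_m1 [of "Suc (card S)" S' x] by simp
    then show ?thesis
      using S' x(1) by (intro exI [of _ "insert x S'"] conjI) simp_all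
  qed
qed

global_interpretation kvs: vector_space "ksmult :: 'k::field \<Rightarrow> ('x \<Rightarrow>\<^sub>0 'k) \<Rightarrow> _"
  by unfold_locales (auto intro!: poly_mapping_eqI simp: lookup_smult lookup_add algebra_simps)

text \<open>The set \<open>S\<close> need not lie in \<open>Z\<close>, which makes the notion trivially monotone in \<open>Z\<close>.\<close>

definition rank_le :: "('x \<Rightarrow>\<^sub>0 'k::field) set \<Rightarrow> ('x \<Rightarrow>\<^sub>0 'k) set \<Rightarrow> nat \<Rightarrow> bool" where
  "rank_le Z B m \<longleftrightarrow> (\<exists>S. finite S \<and> card S \<le> m \<and> Z \<subseteq> kvs.span (S \<union> B))"

lemma rank_leI: "finite S \<Longrightarrow> card S \<le> m \<Longrightarrow> Z \<subseteq> kvs.span (S \<union> B) \<Longrightarrow> rank_le Z B m"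
  by (auto simp: rank_le_def)

lemma rank_le_subset: "Z \<subseteq> B \<Longrightarrow> rank_le Z B m"
  using kvs.span_superset [of B] by (intro rank_leI [of "{}"]) auto

lemma rank_le_mono: "rank_le Z B m \<Longrightarrow> m \<le> n \<Longrightarrow> rank_le Z B n"
  by (auto simp: rank_le_def intro: order_trans)

lemma subspace_kcycles: "kvs.subspace (kcycles p X)"
  by (rule kvs.subspaceI)
    (auto simp: kcycles_def singular_kchain_add kchain_boundary_add singular_kchain_smult kchain_boundary_smult)

lemma subspace_kboundaries: "kvs.subspace (kboundaries p X)"
proof (rule kvs.subspaceI)
  show "0 \<in> kboundaries p X"
    by (auto simp: kboundaries_def intro: image_eqI [where x = 0])
qed (auto simp: kboundaries_def kchain_boundary_add [symmetric] kchain_boundary_smult [symmetric]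
    singular_kchain_add singular_kchain_smult)

lemma kboundaries_subset_kcycles: "kboundaries p X \<subseteq> kcycles p X"
  by (auto simp: kboundaries_def kcycles_def singular_kchain_boundary kchain_boundary_boundary)

lemma kboundaries_mono: "S \<subseteq> T \<Longrightarrow> kboundaries p (subtopology X S) \<subseteq> kboundaries p (subtopology X T)"
  by (auto simp: kboundaries_def intro: singular_kchain_mono)

lemma singular_kchain_empty:
  assumes "topspace X = {}" "singular_kchain p X c"
  shows "c = 0"
proof -
  have "Poly_Mapping.keys c = {}"
    using assms(2) singular_simplex_empty [OF assms(1)] unfolding singular_kchain_def by blast
  then show ?thesis by simp
qed

lemma singular_kchain_subtopology_Int:
  "singular_kchain p (subtopology X S) c \<Longrightarrow> singular_kchain p (subtopology X T) c
     \<Longrightarrow> singular_kchain p (subtopology X (S \<inter> T)) c"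
  by (simp add: singular_kchain_def singular_simplex_subtopology subset_iff)


section \<open>Reduced cycles\<close>

text \<open>The augmentation is encoded as push-forward to the type \<open>unit\<close>. Degrees
  start at 0, so the empty space has no reduced homology, in accordance with its counting as
  contractible.\<close>

definition reduced_kcycles :: "nat \<Rightarrow> 'a topology \<Rightarrow> ('a, 'k::field) kchain set" where
  "reduced_kcycles p X = {z \<in> kcycles p X. p = 0 \<longrightarrow> kchain_map 0 (\<lambda>_. ()) z = 0}"

abbreviation point_topology :: "unit topology" where
  "point_topology \<equiv> discrete_topology UNIV"

lemma reduced_kcycles_Suc [simp]: "reduced_kcycles (Suc p) X = kcycles (Suc p) X"
  by (simp add: reduced_kcycles_def)

lemma subspace_reduced_kcycles: "kvs.subspace (reduced_kcycles p X)"
  using subspace_kcycles [of p X] unfolding kvs.subspace_def reduced_kcycles_def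
  by (auto simp: kchain_map_add kchain_map_ksmult)

lemma singular_simplex_point: "singular_simplex p point_topology f"
  by (subst singular_simplex_singleton [of _ "()"]) (auto simp: UNIV_unit)

lemma kext_zero: "kext (\<lambda>_. 0) c = 0"
  by (rule poly_mapping_eqI) (simp add: lookup_kext)

text \<open>All \<open>p + 1\<close> faces are the same simplex with alternating signs: they cancel
  in pairs for odd \<open>p\<close> and leave one for even \<open>p\<close>.\<close>

lemma chain_boundary_point:
  fixes f :: "(nat \<Rightarrow> real) \<Rightarrow> unit"
  assumes "p > 0"
  shows "chain_boundary p (frag_of f) = (if odd p then 0 else frag_of (\<lambda>_. ()))"
  using assms chain_boundary_of_singleton [of point_topology "()" p "frag_of f"]
  by (auto simp: singular_chain_of singular_simplex_point [unfolded UNIV_unit] UNIV_unit restrict_def)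

text \<open>The boundary maps of a point alternate between zero and the identity. For odd
  \<open>p\<close> the cycle is the boundary of the same chain read one degree higher; for even
  \<open>p\<close> a cycle equals its boundary, which is zero.\<close>

lemma kcycles_point:
  assumes "p > 0"
  shows "(kcycles p point_topology :: (unit, 'k::field) kchain set) \<subseteq> kboundaries p point_topology"
proof
  fix z :: "(unit, 'k) kchain"
  assume z: "z \<in> kcycles p point_topology"
  have triv: "kext (\<lambda>_. frag_of (\<lambda>_. ())) z = z"
  proof -
    have "kext (\<lambda>_. frag_of (\<lambda>_. ())) z = kext frag_of z"
      by (rule kext_cong) (auto intro!: arg_cong [where f = frag_of])
    then show ?thesis by simp
  qed
  show "z \<in> kboundaries p point_topology"
  proof (cases "odd p")
    case True
    have "kchain_boundary (Suc p) z = z"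
      unfolding kchain_boundary_eq_kext using True triv by (simp add: chain_boundary_point)
    moreover have "singular_kchain (Suc p) point_topology z"
      by (auto simp: singular_kchain_def singular_simplex_point)
    ultimately show ?thesis
      unfolding kboundaries_def by (metis (mono_tags, lifting) imageI mem_Collect_eq)
  next
    case False
    then have "kchain_boundary p z = z"
      unfolding kchain_boundary_eq_kext using assms triv by (simp add: chain_boundary_point)
    then show ?thesis
      using z kvs.subspace_0 [OF subspace_kboundaries] by (auto simp: kcycles_def)
  qed
qed

text \<open>Push-forward to a point commutes with boundaries, and over a point the boundary from
  degree 1 to degree 0 is zero.\<close>

lemma kboundaries_subset_reduced_kcycles:
  "(kboundaries p X :: ('a, 'k::field) kchain set) \<subseteq> reduced_kcycles p X"
proof
  fix z :: "('a, 'k) kchain" assume z: "z \<in> kboundaries p X"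
  have "kchain_map 0 (\<lambda>_. ()) z = 0" if "p = 0"
  proof -
    obtain d where d: "singular_kchain 1 X d" "z = kchain_boundary 1 d"
      using z \<open>p = 0\<close> by (auto simp: kboundaries_def)
    then have "kchain_map 0 (\<lambda>_. ()) z = kchain_boundary 1 (kchain_map 1 (\<lambda>_. ()) d)"
      using kchain_boundary_kchain_map [OF d(1), of "\<lambda>_. ()"] by simp
    also have "\<dots> = 0"
      unfolding kchain_boundary_eq_kext by (simp add: chain_boundary_point kext_zero)
    finally show ?thesis .
  qed
  then show "z \<in> reduced_kcycles p X"
    using z kboundaries_subset_kcycles by (auto simp: reduced_kcycles_def)
qed

text \<open>The contraction makes \<open>z\<close> homologous to its image under a constant map,
  which factors through the one-point space. There positive-degree cycles bound, and in degree 0 the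
  image vanishes by reducedness.\<close>

lemma reduced_kcycles_contractible:
  assumes "contractible_space X"
  shows "(reduced_kcycles p X :: ('a, 'k::field) kchain set) \<subseteq> kboundaries p X"
proof
  fix z :: "('a, 'k) kchain"
  assume z: "z \<in> reduced_kcycles p X"
  then have cyc: "z \<in> kcycles p X" by (simp add: reduced_kcycles_def)
  show "z \<in> kboundaries p X"
  proof (cases "topspace X = {}")
    case True
    then have "z = 0" using cyc singular_kchain_empty by (auto simp: kcycles_def)
    then show ?thesis using kvs.subspace_0 [OF subspace_kboundaries] by simp
  next
    case False
    obtain a where a: "homotopic_with (\<lambda>_. True) X X id (\<lambda>x. a)"
      using assms by (auto simp: contractible_space_def)
    then have "continuous_map X X (\<lambda>x. a)"
      using homotopic_with_imp_continuous_maps by blast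
    then have aX: "a \<in> topspace X"
      using False by (auto simp: continuous_map_def)
    have const: "kchain_map p (\<lambda>_. a) z = kchain_map p (\<lambda>_. a) (kchain_map p (\<lambda>_. ()) z)"
      by (simp add: kchain_map_compose o_def)
    have "kchain_map p (\<lambda>_. a) z \<in> kboundaries p X"
    proof (cases "p = 0")
      case True
      then have "kchain_map p (\<lambda>_. a) z = 0"
        using z unfolding const by (simp add: reduced_kcycles_def)
      then show ?thesis using kvs.subspace_0 [OF subspace_kboundaries] by simp
    next
      case False
      have "kchain_map p (\<lambda>_. ()) z \<in> kcycles p point_topology"
        by (rule kchain_map_kcycles [OF cyc]) simp
      then show ?thesis
        unfolding const using kcycles_point [of p] False aX
        by (intro kchain_map_kboundaries [of _ _ point_topology]) auto
    qed
    moreover have "kchain_map p (\<lambda>_. a) z - kchain_map p id z \<in> kboundaries p X"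
      by (rule homotopic_imp_kchain_maps_homologous [OF a cyc])
    moreover have "kchain_map p id z = z"
      using cyc by (intro kchain_map_ident) (auto simp: kcycles_def)
    ultimately show ?thesis
      using kvs.subspace_diff [OF subspace_kboundaries] by fastforce
  qed
qed


section \<open>The Mayer--Vietoris estimates\<close>

text \<open>Generators for the union are those of \<open>A\<close> together with one glued cycle for
  each generator of the cycles of the intersection that bound on both sides. \<open>V\<close>
  contributes none, being contractible.\<close>

lemma mayer_vietoris_rank_Suc:
  fixes Y :: "'a topology"
  assumes A: "openin Y A" and V: "openin Y V" and contr: "contractible_space (subtopology Y V)"
    and rA: "rank_le (reduced_kcycles (Suc p) (subtopology Y A) :: ('a, 'k::field) kchain set)
               (kboundaries (Suc p) (subtopology Y A)) a"
    and rW: "rank_le (reduced_kcycles p (subtopology Y (A \<inter> V)) :: ('a, 'k) kchain set)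
               (kboundaries p (subtopology Y (A \<inter> V))) b"
  shows "rank_le (reduced_kcycles (Suc p) (subtopology Y (A \<union> V)) :: ('a, 'k) kchain set)
           (kboundaries (Suc p) (subtopology Y (A \<union> V))) (a + b)"
proof -
  let ?A = "subtopology Y A" and ?V = "subtopology Y V"
  let ?W = "subtopology Y (A \<inter> V)" and ?U = "subtopology Y (A \<union> V)"
  let ?B = "kboundaries :: nat \<Rightarrow> 'a topology \<Rightarrow> ('a, 'k) kchain set"
  obtain S\<^sub>A where S\<^sub>A: "finite S\<^sub>A" "card S\<^sub>A \<le> a"
    "kcycles (Suc p) ?A \<subseteq> kvs.span (S\<^sub>A \<union> ?B (Suc p) ?A)"
    using rA by (auto simp: rank_le_def)
  \<comment> \<open>\<open>K\<close> is the image of the connecting homomorphism at the level of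
    cycles: the kernel of passing from the intersection to both pieces.\<close>
  define K where "K = reduced_kcycles p ?W \<inter> ?B p ?A \<inter> ?B p ?V"
  have K: "kvs.subspace K"
    unfolding K_def by (intro kvs.subspace_inter subspace_reduced_kcycles subspace_kboundaries)
  have BK: "?B p ?W \<subseteq> K"
    unfolding K_def using kboundaries_subset_reduced_kcycles kboundaries_mono [of "A \<inter> V" _ p Y]
    by blast
  obtain S\<^sub>W where S\<^sub>W: "finite S\<^sub>W" "card S\<^sub>W \<le> b" "K \<subseteq> kvs.span (S\<^sub>W \<union> ?B p ?W)"
    using rW unfolding rank_le_def K_def by blast
  \<comment> \<open>The generators are moved into \<open>K\<close> because each of them needs a
    filling in \<open>A\<close> and another in \<open>V\<close>.\<close>
  then obtain S where S: "finite S" "card S \<le> b" "S \<subseteq> K" "K \<subseteq> kvs.span (S \<union> ?B p ?W)"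
    using kvs.relative_generators_in_subspace [OF S\<^sub>W(1) K BK S\<^sub>W(3)] by force
  have "\<exists>\<alpha>. singular_kchain (Suc p) ?A \<alpha> \<and> kchain_boundary (Suc p) \<alpha> = s" if "s \<in> S" for s
    using S(3) that by (auto simp: K_def kboundaries_def)
  then obtain \<alpha> where \<alpha>: "\<And>s. s \<in> S \<Longrightarrow> singular_kchain (Suc p) ?A (\<alpha> s)"
      "\<And>s. s \<in> S \<Longrightarrow> kchain_boundary (Suc p) (\<alpha> s) = s"
    by metis
  have "\<exists>\<beta>. singular_kchain (Suc p) ?V \<beta> \<and> kchain_boundary (Suc p) \<beta> = s" if "s \<in> S" for s
    using S(3) that by (auto simp: K_def kboundaries_def)
  then obtain \<beta> where \<beta>: "\<And>s. s \<in> S \<Longrightarrow> singular_kchain (Suc p) ?V (\<beta> s)"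
      "\<And>s. s \<in> S \<Longrightarrow> kchain_boundary (Suc p) (\<beta> s) = s"
    by metis
  \<comment> \<open>Two fillings of the same \<open>s\<close> glue to a cycle of the union.\<close>
  define w where "w s = \<alpha> s - \<beta> s" for s
  txt \<open>\<open>L\<close> replaces the connecting homomorphism, which has no canonical chain-level lift.\<close>
  define L where "L = {k. \<exists>\<xi> \<eta>. singular_kchain (Suc p) ?A \<xi> \<and> singular_kchain (Suc p) ?V \<eta> \<and>
     kchain_boundary (Suc p) \<xi> = k \<and> kchain_boundary (Suc p) \<eta> = k \<and> \<xi> - \<eta> \<in> kvs.span (w ` S)}"
  have "kvs.subspace L"
  proof (rule kvs.subspaceI)
    show "0 \<in> L"
      unfolding L_def by (auto intro!: exI [of _ 0] simp: kvs.span_zero)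
  next
    fix k l assume "k \<in> L" "l \<in> L"
    then obtain \<xi> \<eta> \<xi>' \<eta>' where
      k: "singular_kchain (Suc p) ?A \<xi>" "singular_kchain (Suc p) ?V \<eta>" "kchain_boundary (Suc p) \<xi> = k"
         "kchain_boundary (Suc p) \<eta> = k" "\<xi> - \<eta> \<in> kvs.span (w ` S)" and
      l: "singular_kchain (Suc p) ?A \<xi>'" "singular_kchain (Suc p) ?V \<eta>'" "kchain_boundary (Suc p) \<xi>' = l"
         "kchain_boundary (Suc p) \<eta>' = l" "\<xi>' - \<eta>' \<in> kvs.span (w ` S)"
      unfolding L_def by blast
    have "(\<xi> + \<xi>') - (\<eta> + \<eta>') \<in> kvs.span (w ` S)"
      using kvs.span_add [OF k(5) l(5)] by (simp add: algebra_simps)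
    then show "k + l \<in> L"
      unfolding L_def using k l
      by (intro CollectI exI [of _ "\<xi> + \<xi>'"] exI [of _ "\<eta> + \<eta>'"])
        (auto simp: singular_kchain_add kchain_boundary_add)
  next
    fix c k assume "k \<in> L"
    then obtain \<xi> \<eta> where
      k: "singular_kchain (Suc p) ?A \<xi>" "singular_kchain (Suc p) ?V \<eta>" "kchain_boundary (Suc p) \<xi> = k"
         "kchain_boundary (Suc p) \<eta> = k" "\<xi> - \<eta> \<in> kvs.span (w ` S)"
      unfolding L_def by blast
    have "ksmult c \<xi> - ksmult c \<eta> \<in> kvs.span (w ` S)"
      using kvs.span_scale [OF k(5), of c] by (simp add: kvs.scale_right_diff_distrib)
    then show "ksmult c k \<in> L"
      unfolding L_def using k
      by (intro CollectI exI [of _ "ksmult c \<xi>"] exI [of _ "ksmult c \<eta>"])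
        (auto simp: singular_kchain_smult kchain_boundary_smult)
  qed
  moreover have "S \<subseteq> L"
  proof
    fix s assume "s \<in> S"
    then show "s \<in> L"
      unfolding L_def using \<alpha> \<beta> kvs.span_base [of "w s" "w ` S"]
      by (intro CollectI exI [of _ "\<alpha> s"] exI [of _ "\<beta> s"]) (auto simp: w_def)
  qed
  moreover have "?B p ?W \<subseteq> L"
  proof
    fix k assume "k \<in> ?B p ?W"
    then obtain u where "singular_kchain (Suc p) ?W u" "kchain_boundary (Suc p) u = k"
      by (auto simp: kboundaries_def)
    then show "k \<in> L"
      unfolding L_def using singular_kchain_mono [of "Suc p" Y "A \<inter> V" u]
      by (intro CollectI exI [of _ u]) (auto simp: kvs.span_zero)
  qed
  \<comment> \<open>Hence each element of \<open>K\<close> has fillings on both sides whose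
    difference is a combination of the chosen glued cycles.\<close>
  ultimately have KL: "K \<subseteq> L"
    using S(4) kvs.span_minimal [of "S \<union> ?B p ?W" L] by blast
  let ?T = "S\<^sub>A \<union> w ` S"
  let ?span = "kvs.span (?T \<union> ?B (Suc p) ?U)"
  have "kcycles (Suc p) ?U \<subseteq> ?span"
  proof
    fix z :: "('a, 'k) kchain" assume z: "z \<in> kcycles (Suc p) ?U"
    have "openin ?U A" "openin ?U V" "topspace ?U \<subseteq> A \<union> V"
      using A V by (auto simp: openin_open_subtopology openin_Un)
    then obtain x y where xy: "singular_kchain (Suc p) (subtopology ?U A) x"
        "singular_kchain (Suc p) (subtopology ?U V) y" "x + y - z \<in> ?B (Suc p) ?U"
      by (rule kcycle_split [OF z])
    then have x: "singular_kchain (Suc p) ?A x" and y: "singular_kchain (Suc p) ?V y"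
      by (auto simp: subtopology_subtopology Int_Un_distrib2 Un_Int_distrib2 Int_absorb2 Int_absorb1)
    have ny: "singular_kchain (Suc p) ?V (- y)"
      using singular_kchain_diff [OF singular_kchain_0 y] by simp
    have "kchain_boundary (Suc p) (x + y - z) = 0" "kchain_boundary (Suc p) z = 0"
      using xy(3) z kboundaries_subset_kcycles by (auto simp: kcycles_def)
    then have bd: "kchain_boundary (Suc p) x = kchain_boundary (Suc p) (- y)"
      using kchain_boundary_diff [of "Suc p" 0 y]
      by (simp add: kchain_boundary_diff kchain_boundary_add add_eq_0_iff2)
    have BV: "kchain_boundary (Suc p) x \<in> ?B p ?V"
      using ny unfolding kboundaries_def bd by blast
    have BA: "kchain_boundary (Suc p) x \<in> ?B p ?A"
      using x unfolding kboundaries_def by blast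
    have "singular_kchain p ?W (kchain_boundary (Suc p) x)"
      using singular_kchain_boundary [OF x] singular_kchain_boundary [OF ny, folded bd]
      by (rule singular_kchain_subtopology_Int)
    \<comment> \<open>The augmentation condition for \<open>p = 0\<close> is inherited from
      \<open>V\<close>, where the chain is a boundary.\<close>
    then have "kchain_boundary (Suc p) x \<in> reduced_kcycles p ?W"
      using BV kboundaries_subset_reduced_kcycles [of p ?V]
      by (auto simp: reduced_kcycles_def kcycles_def)
    then have "kchain_boundary (Suc p) x \<in> L"
      using KL BA BV by (auto simp: K_def)
    then obtain \<xi> \<eta> where
      k: "singular_kchain (Suc p) ?A \<xi>" "singular_kchain (Suc p) ?V \<eta>"
         "kchain_boundary (Suc p) \<xi> = kchain_boundary (Suc p) x"
         "kchain_boundary (Suc p) \<eta> = kchain_boundary (Suc p) x" "\<xi> - \<eta> \<in> kvs.span (w ` S)"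
      unfolding L_def by blast
    have "x - \<xi> \<in> kcycles (Suc p) ?A"
      using x k by (simp add: kcycles_def singular_kchain_diff kchain_boundary_diff)
    then have "x - \<xi> \<in> kvs.span (S\<^sub>A \<union> ?B (Suc p) ?A)"
      using S\<^sub>A(3) by blast
    then have 1: "x - \<xi> \<in> ?span"
      using kvs.span_mono [of "S\<^sub>A \<union> ?B (Suc p) ?A" "?T \<union> ?B (Suc p) ?U"] kboundaries_mono [of A "A \<union> V"]
      by blast
    have "\<eta> - (- y) \<in> kcycles (Suc p) ?V"
      unfolding kcycles_def using ny k by (simp only: mem_Collect_eq singular_kchain_diff kchain_boundary_diff bd) simp
    then have "\<eta> + y \<in> ?B (Suc p) ?V"
      using reduced_kcycles_contractible [OF contr, of "Suc p"] by auto
    then have 2: "\<eta> + y \<in> ?span"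
      using kvs.span_superset [of "?T \<union> ?B (Suc p) ?U"] kboundaries_mono [of V "A \<union> V"] by blast
    have 3: "\<xi> - \<eta> \<in> ?span"
      using k(5) kvs.span_mono [of "w ` S" "?T \<union> ?B (Suc p) ?U"] by blast
    have 4: "x + y - z \<in> ?span"
      using xy(3) by (intro kvs.span_base) auto
    \<comment> \<open>The summands are a cycle of \<open>A\<close>, a cycle of \<open>V\<close> and
      hence a boundary, a combination of glued cycles, and the boundary by which the splitting of
      \<open>z\<close> was inexact.\<close>
    have "z = (x - \<xi>) + (\<eta> + y) + (\<xi> - \<eta>) - (x + y - z)"
      by simp
    also have "\<dots> \<in> ?span"
      by (intro kvs.span_diff kvs.span_add 1 2 3 4)
    finally show "z \<in> ?span" .
  qed
  moreover have "finite ?T" "card ?T \<le> a + b"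
    using S\<^sub>A S card_Un_le [of S\<^sub>A "w ` S"] card_image_le [OF S(1), of w] by auto
  ultimately show ?thesis
    by (intro rank_leI [of ?T]) auto
qed

section \<open>Degree zero\<close>

definition vertex :: "'a \<Rightarrow> ('a, 'k::field) kchain" where
  "vertex a = Poly_Mapping.single (\<lambda>x\<in>standard_simplex 0. a) 1"

lemma singular_kchain_vertex: "a \<in> topspace X \<Longrightarrow> singular_kchain 0 X (vertex a)"
  by (auto simp: vertex_def singular_kchain_def singular_simplex_def)

lemma kchain_map_vertex: "kchain_map 0 (\<lambda>_. ()) (vertex a) = Poly_Mapping.single (\<lambda>_. ()) 1"
  by (rule poly_mapping_eqI)
    (auto simp: kchain_map_def vertex_def lookup_kext lookup_single when_def fun_eq_iff)

text \<open>The 0-chains of a point form a line spanned by the image of any vertex; \<open>s\<close>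
  is the sum of the coefficients of \<open>x\<close>.\<close>

lemma kchain_map_point_eq_vertex:
  obtains s where "kchain_map 0 (\<lambda>_. ()) x = ksmult s (kchain_map 0 (\<lambda>_. ()) (vertex a))"
proof -
  have "kchain_map 0 (\<lambda>_. ()) x = ksmult (Poly_Mapping.lookup (kchain_map 0 (\<lambda>_. ()) x) (\<lambda>_. ()))
       (kchain_map 0 (\<lambda>_. ()) (vertex a))"
    unfolding kchain_map_vertex
    by (rule poly_mapping_eqI) (auto simp: lookup_smult lookup_single when_def
        intro!: arg_cong2 [where f = Poly_Mapping.lookup])
  then show thesis by (rule that)
qed

lemma kcycles_0: "kcycles 0 X = {c. singular_kchain 0 X c}"
  by (simp add: kcycles_def kchain_boundary_def)

text \<open>A contractible piece adds at most one component, and the difference of a vertex in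
  \<open>A\<close> and a vertex in \<open>V\<close> accounts for it.\<close>

lemma mayer_vietoris_rank_0:
  fixes Y :: "'a topology"
  assumes A: "openin Y A" and V: "openin Y V" and contr: "contractible_space (subtopology Y V)"
    and rA: "rank_le (reduced_kcycles 0 (subtopology Y A) :: ('a, 'k::field) kchain set)
               (kboundaries 0 (subtopology Y A)) m"
  shows "rank_le (reduced_kcycles 0 (subtopology Y (A \<union> V)) :: ('a, 'k) kchain set)
           (kboundaries 0 (subtopology Y (A \<union> V))) (Suc m)"
proof (cases "A = {} \<or> V = {}")
  \<comment> \<open>Without a vertex on one side, the union is just the other piece, whose rank is
    already bounded.\<close>
  case True
  then show ?thesis
    using rank_le_mono [OF rA, of "Suc m"] rank_le_subset [OF reduced_kcycles_contractible [OF contr]] by auto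
next
  case False
  let ?A = "subtopology Y A" and ?V = "subtopology Y V" and ?U = "subtopology Y (A \<union> V)"
  let ?B = "kboundaries :: nat \<Rightarrow> 'a topology \<Rightarrow> ('a, 'k) kchain set"
  let ?u = "kchain_map 0 (\<lambda>_. ()) :: ('a, 'k) kchain \<Rightarrow> (unit, 'k) kchain"
  obtain a v where a: "a \<in> A" and v: "v \<in> V" using False by auto
  have sub: "A \<subseteq> topspace Y" "V \<subseteq> topspace Y"
    using A V openin_subset by auto
  obtain S where S: "finite S" "card S \<le> m" "reduced_kcycles 0 ?A \<subseteq> kvs.span (S \<union> ?B 0 ?A)"
    using rA by (auto simp: rank_le_def)
  let ?T = "insert (vertex a - vertex v) S"
  let ?span = "kvs.span (?T \<union> ?B 0 ?U)"
  have uv: "?u (vertex a) = ?u (vertex v)"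
    by (simp add: kchain_map_vertex)
  have "reduced_kcycles 0 ?U \<subseteq> ?span"
  proof
    fix z :: "('a, 'k) kchain" assume z: "z \<in> reduced_kcycles 0 ?U"
    then have "z \<in> kcycles 0 ?U" by (simp add: reduced_kcycles_def)
    moreover have "openin ?U A" "openin ?U V" "topspace ?U \<subseteq> A \<union> V"
      using A V by (auto simp: openin_open_subtopology openin_Un)
    ultimately obtain x y where xy: "singular_kchain 0 (subtopology ?U A) x"
        "singular_kchain 0 (subtopology ?U V) y" "x + y - z \<in> ?B 0 ?U"
      by (rule kcycle_split)
    then have x: "singular_kchain 0 ?A x" and y: "singular_kchain 0 ?V y"
      by (auto simp: subtopology_subtopology Int_Un_distrib2 Un_Int_distrib2 Int_absorb2 Int_absorb1)
    \<comment> \<open>Taking the vertex of \<open>A\<close> away \<open>s\<close> times and adding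
      the vertex of \<open>V\<close> as often makes both parts reduced, since the coefficient sums
      of \<open>x\<close> and \<open>y\<close> are opposite.\<close>
    obtain s where s: "?u x = ksmult s (?u (vertex a))"
      by (rule kchain_map_point_eq_vertex)
    have "?u (x + y - z) = 0" "?u z = 0"
      using z xy(3) kboundaries_subset_reduced_kcycles by (auto simp: reduced_kcycles_def)
    then have uy: "?u x + ?u y = 0"
      by (simp add: kchain_map_add kchain_map_diff)
    have "x - ksmult s (vertex a) \<in> reduced_kcycles 0 ?A"
      using x s a sub
      by (auto simp: reduced_kcycles_def kcycles_0 kchain_map_diff kchain_map_ksmult
          intro!: singular_kchain_diff singular_kchain_smult singular_kchain_vertex)
    then have "x - ksmult s (vertex a) \<in> kvs.span (S \<union> ?B 0 ?A)"
      using S(3) by blast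
    then have 1: "x - ksmult s (vertex a) \<in> ?span"
      using kvs.span_mono [of "S \<union> ?B 0 ?A" "?T \<union> ?B 0 ?U"] kboundaries_mono [of A "A \<union> V"] by blast
    have "y + ksmult s (vertex v) \<in> reduced_kcycles 0 ?V"
      using y s v sub uy uv
      by (auto simp: reduced_kcycles_def kcycles_0 kchain_map_add kchain_map_ksmult add.commute
          intro!: singular_kchain_add singular_kchain_smult singular_kchain_vertex)
    then have "y + ksmult s (vertex v) \<in> ?B 0 ?V"
      using reduced_kcycles_contractible [OF contr, of 0] by auto
    then have 2: "y + ksmult s (vertex v) \<in> ?span"
      using kvs.span_superset [of "?T \<union> ?B 0 ?U"] kboundaries_mono [of V "A \<union> V"] by blast
    have 3: "ksmult s (vertex a - vertex v) \<in> ?span"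
      by (intro kvs.span_scale kvs.span_base) auto
    have 4: "x + y - z \<in> ?span"
      using xy(3) by (intro kvs.span_base) auto
    have "z = (x - ksmult s (vertex a)) + (y + ksmult s (vertex v)) + ksmult s (vertex a - vertex v)
        - (x + y - z)"
      by (simp add: kvs.scale_right_diff_distrib)
    also have "\<dots> \<in> ?span"
      by (intro kvs.span_diff kvs.span_add 1 2 3 4)
    finally show "z \<in> ?span" .
  qed
  moreover have "card ?T \<le> Suc m"
    using S card_insert_le_m1 [of "Suc m" S] by auto
  ultimately show ?thesis
    using S(1) by (intro rank_leI [of ?T]) auto
qed

text \<open>Empty intersections count as contractible, so the hypotheses pass to the traces on
  \<open>V\<close>. Distinct members may have the same trace, which is why the cardinality is only
  bounded from above. The induction varies the cover and the degree together.\<close>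

lemma rank_le_reduced_kcycles_cover:
  fixes Y :: "'a topology"
  assumes "finite \<U>" "card \<U> \<le> Suc m" "\<And>U. U \<in> \<U> \<Longrightarrow> openin Y U"
    and "\<And>\<F>. \<F> \<noteq> {} \<Longrightarrow> \<F> \<subseteq> \<U> \<Longrightarrow> contractible_space (subtopology Y (\<Inter>\<F>))"
  shows "rank_le (reduced_kcycles p (subtopology Y (\<Union>\<U>)) :: ('a, 'k::field) kchain set)
           (kboundaries p (subtopology Y (\<Union>\<U>))) (m choose Suc p)"
  using assms
proof (induction m arbitrary: \<U> p)
  case 0
  \<comment> \<open>At most one member is left, so the union is empty or that member.\<close>
  have "contractible_space (subtopology Y (\<Union>\<U>))"
  proof (cases "\<U> = {}")
    case False
    then obtain U where "\<U> = {U}"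
      using 0 by (metis card_1_singletonE card_gt_0_iff le_antisym One_nat_def Suc_leI)
    then show ?thesis using 0(4) [of \<U>] by simp
  qed simp
  then show ?case
    by (intro rank_le_subset reduced_kcycles_contractible)
next
  case (Suc m)
  show ?case
  proof (cases "\<U> = {}")
    case True
    then show ?thesis
      by (auto intro!: rank_le_subset reduced_kcycles_contractible)
  next
    case False
    then obtain V \<U>' where \<U>: "\<U> = insert V \<U>'" "V \<notin> \<U>'"
      by (meson ex_in_conv mk_disjoint_insert)
    then have fin: "finite \<U>'" and card: "card \<U>' \<le> Suc m"
      using Suc.prems by auto
    have rA: "rank_le (reduced_kcycles q (subtopology Y (\<Union>\<U>')) :: ('a, 'k) kchain set)
           (kboundaries q (subtopology Y (\<Union>\<U>'))) (m choose Suc q)" for q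
      using \<U> by (intro Suc.IH fin card Suc.prems) auto
    have rW: "rank_le (reduced_kcycles q (subtopology Y (\<Union>\<U>' \<inter> V)) :: ('a, 'k) kchain set)
           (kboundaries q (subtopology Y (\<Union>\<U>' \<inter> V))) (m choose Suc q)" for q
    proof -
      let ?\<W> = "(\<lambda>U. U \<inter> V) ` \<U>'"
      have "rank_le (reduced_kcycles q (subtopology Y (\<Union>?\<W>)) :: ('a, 'k) kchain set)
           (kboundaries q (subtopology Y (\<Union>?\<W>))) (m choose Suc q)"
      proof (rule Suc.IH)
        show "card ?\<W> \<le> Suc m"
          using card card_image_le [OF fin] order_trans by blast
        show "openin Y W" if "W \<in> ?\<W>" for W
          using that Suc.prems(3) \<U> by auto
        fix \<F> assume \<F>: "\<F> \<noteq> {}" "\<F> \<subseteq> ?\<W>"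
        then obtain \<G> where \<G>: "\<G> \<subseteq> \<U>'" "\<F> = (\<lambda>U. U \<inter> V) ` \<G>"
          by (meson subset_imageE)
        then have "\<Inter>\<F> = \<Inter>(insert V \<G>)"
          using \<F>(1) by auto
        then show "contractible_space (subtopology Y (\<Inter>\<F>))"
          using Suc.prems(4) [of "insert V \<G>"] \<G> \<U> by auto
      qed (simp add: fin)
      moreover have "\<Union>?\<W> = \<Union>\<U>' \<inter> V" by auto
      ultimately show ?thesis by simp
    qed
    have A: "openin Y (\<Union>\<U>')" and V: "openin Y V"
      using Suc.prems(3) \<U> by auto
    have contr: "contractible_space (subtopology Y V)"
      using Suc.prems(4) [of "{V}"] \<U> by auto
    have eq: "\<Union>\<U> = \<Union>\<U>' \<union> V"
      using \<U> by auto
    show ?thesis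
    proof (cases p)
      case 0
      then show ?thesis
        unfolding eq using mayer_vietoris_rank_0 [OF A V contr rA [of 0]] by simp
    next
      case (Suc q)
      then show ?thesis
        unfolding eq using mayer_vietoris_rank_Suc [OF A V contr rA [of p, unfolded Suc] rW [of q]]
        by (simp add: add.commute)
    qed
  qed
qed


section \<open>Betti numbers\<close>

text \<open>Passing from reduced to ordinary cycles costs one more generator in degree 0, a single
  vertex: \<open>m choose 1\<close> becomes \<open>Suc m\<close>.\<close>

lemma rank_le_kcycles_cover:
  fixes Y :: "'a topology"
  assumes good: "good_open_cover Y \<U>" and fin: "finite \<U>" and card: "card \<U> = Suc m"
  shows "rank_le (kcycles p Y :: ('a, 'k::field) kchain set) (kboundaries p Y)
           (if p = 0 then Suc m else m choose Suc p)"
proof -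
  have contr: "contractible_space (subtopology Y (\<Inter>\<F>))" if "\<F> \<noteq> {}" "\<F> \<subseteq> \<U>" for \<F>
  proof (cases "\<Inter>\<F> = {}")
    case False
    then show ?thesis
      using that fin finite_subset good_open_coverD [OF good] by blast
  qed simp
  have "subtopology Y (\<Union>\<U>) = Y"
    using good by (simp add: good_open_cover_def)
  then have r: "rank_le (reduced_kcycles p Y :: ('a, 'k) kchain set) (kboundaries p Y) (m choose Suc p)"
    using rank_le_reduced_kcycles_cover [of \<U> m Y p] fin card good contr
    by (simp add: good_open_cover_def)
  show ?thesis
  proof (cases p)
    case 0
    obtain U where "U \<in> \<U>" using card by fastforce
    then have "U \<noteq> {}" "U \<subseteq> topspace Y"
      using good unfolding good_open_cover_def by blast+
    then obtain a where a: "a \<in> topspace Y" by blast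
    obtain S where S: "finite S" "card S \<le> m"
      "(reduced_kcycles 0 Y :: ('a, 'k) kchain set) \<subseteq> kvs.span (S \<union> kboundaries 0 Y)"
      using r 0 by (auto simp: rank_le_def)
    let ?T = "insert (vertex a) S"
    have "(kcycles 0 Y :: ('a, 'k) kchain set) \<subseteq> kvs.span (?T \<union> kboundaries 0 Y)"
    proof
      fix z :: "('a, 'k) kchain" assume z: "z \<in> kcycles 0 Y"
      obtain s where s: "kchain_map 0 (\<lambda>_. ()) z = ksmult s (kchain_map 0 (\<lambda>_. ()) (vertex a))"
        by (rule kchain_map_point_eq_vertex)
      have "z - ksmult s (vertex a) \<in> reduced_kcycles 0 Y"
        using z s a
        by (auto simp: reduced_kcycles_def kcycles_0 kchain_map_diff kchain_map_ksmult
            intro!: singular_kchain_diff singular_kchain_smult singular_kchain_vertex)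
      then have "z - ksmult s (vertex a) \<in> kvs.span (?T \<union> kboundaries 0 Y)"
        using S(3) kvs.span_mono [of "S \<union> kboundaries 0 Y" "?T \<union> kboundaries 0 Y"] by blast
      moreover have "ksmult s (vertex a) \<in> kvs.span (?T \<union> kboundaries 0 Y)"
        by (intro kvs.span_scale kvs.span_base) auto
      ultimately have "(z - ksmult s (vertex a)) + ksmult s (vertex a) \<in> kvs.span (?T \<union> kboundaries 0 Y)"
        by (rule kvs.span_add)
      then show "z \<in> kvs.span (?T \<union> kboundaries 0 Y)" by simp
    qed
    moreover have "card ?T \<le> Suc m"
      using S card_insert_le_m1 [of "Suc m" S] by auto
    ultimately show ?thesis
      using S(1) 0 by (simp add: rank_leI [of ?T])
  next
    case (Suc q)
    then show ?thesis using r by simp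
  qed
qed

text \<open>As \<open>g \<circ> f\<close> is homotopic to the identity, every cycle \<open>z\<close>
  of \<open>X\<close> is homologous to the image under \<open>g\<close> of a cycle of
  \<open>Y\<close>, so the images of the generators generate.\<close>

lemma rank_le_homotopy_equivalent:
  fixes X :: "'a topology" and Y :: "'b topology"
  assumes "Y homotopy_equivalent_space X"
    and r: "rank_le (kcycles p Y :: ('b, 'k::field) kchain set) (kboundaries p Y) m"
  shows "rank_le (kcycles p X :: ('a, 'k) kchain set) (kboundaries p X) m"
proof -
  obtain f g where f: "continuous_map X Y f" and g: "continuous_map Y X g"
    and gf: "homotopic_with (\<lambda>x. True) X X (g \<circ> f) id"
    using assms(1) unfolding homotopy_equivalent_space_def by blast
  obtain S where S: "finite S" "card S \<le> m"
    "(kcycles p Y :: ('b, 'k) kchain set) \<subseteq> kvs.span (S \<union> kboundaries p Y)"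
    using r by (auto simp: rank_le_def)
  let ?g = "kchain_map p g :: ('b, 'k) kchain \<Rightarrow> ('a, 'k) kchain"
  let ?span = "kvs.span (?g ` S \<union> kboundaries p X)"
  have "kvs.subspace {c. ?g c \<in> ?span}"
    by (rule kvs.subspaceI)
      (auto simp: kchain_map_add kchain_map_ksmult kvs.span_zero intro: kvs.span_add kvs.span_scale)
  moreover have "S \<union> kboundaries p Y \<subseteq> {c. ?g c \<in> ?span}"
    using kchain_map_kboundaries [OF _ g] by (auto intro: kvs.span_base)
  ultimately have push: "kvs.span (S \<union> kboundaries p Y) \<subseteq> {c. ?g c \<in> ?span}"
    by (rule kvs.span_minimal [rotated])
  have "kcycles p X \<subseteq> ?span"
  proof
    fix z :: "('a, 'k) kchain" assume z: "z \<in> kcycles p X"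
    have "kchain_map p f z \<in> kcycles p Y"
      by (rule kchain_map_kcycles [OF z f])
    then have "kchain_map p (g \<circ> f) z \<in> ?span"
      using S(3) push by (auto simp flip: kchain_map_compose)
    moreover have "kchain_map p id z - kchain_map p (g \<circ> f) z \<in> ?span"
      using homotopic_imp_kchain_maps_homologous [OF gf z] by (auto intro: kvs.span_base)
    moreover have "kchain_map p id z = z"
      using z by (intro kchain_map_ident) (auto simp: kcycles_def)
    ultimately have "(z - kchain_map p (g \<circ> f) z) + kchain_map p (g \<circ> f) z \<in> ?span"
      by (intro kvs.span_add) simp_all
    then show "z \<in> ?span" by simp
  qed
  then show ?thesis
    using S card_image_le [OF S(1), of ?g] by (intro rank_leI [of "?g ` S"]) auto
qed

text \<open>The cosets of the generators span the quotient record \<open>homology_space p X\<close>,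
  which turns a rank bound on chains into a dimension bound.\<close>

lemma betti_number_le:
  fixes X :: "'a topology"
  assumes "rank_le (kcycles p X :: ('a, 'k::field) kchain set) (kboundaries p X) m"
  shows "betti_number TYPE('k) X p \<le> enat m"
proof -
  let ?B = "kboundaries p X :: ('a, 'k) kchain set"
  let ?H = "homology_space p X :: ('k, ('a, 'k) kchain set) module"
  obtain S' where S': "finite S'" "card S' \<le> m" "kcycles p X \<subseteq> kvs.span (S' \<union> ?B)"
    using assms by (auto simp: rank_le_def)
  \<comment> \<open>Generators have to be cycles for their cosets to lie in the carrier of the
    quotient.\<close>
  obtain S where S: "finite S" "card S \<le> card S'" "S \<subseteq> kcycles p X" "kcycles p X \<subseteq> kvs.span (S \<union> ?B)"
    using kvs.relative_generators_in_subspace [OF S'(1) subspace_kcycles kboundaries_subset_kcycles S'(3)]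
    by (elim exE conjE)
  interpret H: vectorspace class_ring ?H
    by (rule vectorspace_homology_space)
  have sub: "kvs.subspace ?B"
    by (rule subspace_kboundaries)
  define cl where "cl x = (\<lambda>b. b + x) ` ?B" for x
  have cl: "?B +>\<^bsub>kcycle_space p X\<^esub> x = cl x" for x
    by (auto simp: a_r_coset_def' kcycle_space_def cl_def)
  have cl_add: "cl (x + b) = cl x" if "b \<in> ?B" for x b
  proof (intro equalityI subsetI)
    fix y assume "y \<in> cl (x + b)"
    then obtain b' where "b' \<in> ?B" "y = (b' + b) + x" by (auto simp: cl_def algebra_simps)
    then show "y \<in> cl x" using kvs.subspace_add [OF sub _ that] by (auto simp: cl_def)
  next
    fix y assume "y \<in> cl x"
    then obtain b' where "b' \<in> ?B" "y = (b' - b) + (x + b)" by (auto simp: cl_def algebra_simps)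
    then show "y \<in> cl (x + b)" using kvs.subspace_diff [OF sub _ that] unfolding cl_def by blast
  qed
  have carrier: "carrier ?H = cl ` kcycles p X"
    by (auto simp: homology_space_def quotient_module_def A_RCOSETS_def' cl) 
      (auto simp: kcycle_space_def)
  have plus: "cl x \<oplus>\<^bsub>?H\<^esub> cl y = cl (x + y)" for x y
  proof -
    have "cl x \<oplus>\<^bsub>?H\<^esub> cl y = (\<Union>h\<in>cl x. \<Union>k\<in>cl y. {h + k})"
      by (simp add: homology_space_def quotient_module_def set_add_def' kcycle_space_def)
    also have "\<dots> = cl (x + y)"
    proof (intro equalityI subsetI)
      fix w assume "w \<in> (\<Union>h\<in>cl x. \<Union>k\<in>cl y. {h + k})"
      then obtain b c where "b \<in> ?B" "c \<in> ?B" "w = (b + c) + (x + y)"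
        by (auto simp: cl_def algebra_simps)
      then show "w \<in> cl (x + y)"
        using kvs.subspace_add [OF sub] unfolding cl_def by blast
    next
      fix w assume "w \<in> cl (x + y)"
      then obtain b where b: "b \<in> ?B" "w = (b + x) + (0 + y)"
        by (auto simp: cl_def algebra_simps)
      then have "b + x \<in> cl x" "0 + y \<in> cl y"
        using kvs.subspace_0 [OF sub] unfolding cl_def by blast+
      then show "w \<in> (\<Union>h\<in>cl x. \<Union>k\<in>cl y. {h + k})"
        using b by blast
    qed
    finally show ?thesis .
  qed
  have scale: "a \<odot>\<^bsub>?H\<^esub> cl x = cl (ksmult a x)" for a x
  proof -
    have const: "cl (ksmult a y) = cl (ksmult a x)" if y: "y \<in> cl x" for y
    proof -
      obtain b where b: "y = b + x" "b \<in> ?B"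
        using y unfolding cl_def by (rule imageE)
      have "cl (ksmult a x + ksmult a b) = cl (ksmult a x)"
        by (rule cl_add [OF kvs.subspace_scale [OF sub b(2)]])
      then show ?thesis
        by (simp only: b(1) kvs.scale_right_distrib add.commute [of b])
    qed
    have "x \<in> cl x"
      unfolding cl_def using kvs.subspace_0 [OF sub] by (rule image_eqI [rotated]) simp
    have "a \<odot>\<^bsub>?H\<^esub> cl x = (\<Union>y\<in>cl x. cl (ksmult a y))"
      by (simp add: homology_space_def quotient_module_def cl) (simp add: kcycle_space_def)
    also have "\<dots> = (\<Union>y\<in>cl x. cl (ksmult a x))"
      by (rule SUP_cong [OF refl const])
    also have "\<dots> = cl (ksmult a x)"
      using \<open>x \<in> cl x\<close> by blast
    finally show ?thesis .
  qed
  have zero: "\<zero>\<^bsub>?H\<^esub> = cl 0"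
    by (simp add: homology_space_def quotient_module_def cl_def)
  have G: "cl ` S \<subseteq> carrier ?H"
    using S(3) by (auto simp: carrier)
  interpret N: LinearCombinations.submodule class_ring "H.span (cl ` S)" ?H
    by (rule H.span_is_submodule [OF G])
  \<comment> \<open>The span of the cosets is pulled back to chains, where minimality of
    \<open>kvs.span\<close> applies.\<close>
  have "kvs.subspace {x. cl x \<in> H.span (cl ` S)}"
  proof (rule kvs.subspaceI)
    show "0 \<in> {x. cl x \<in> H.span (cl ` S)}"
      using N.zero_closed by (simp add: zero)
    show "x + y \<in> {x. cl x \<in> H.span (cl ` S)}"
      if "x \<in> {x. cl x \<in> H.span (cl ` S)}" "y \<in> {x. cl x \<in> H.span (cl ` S)}" for x y
      using that N.m_closed [of "cl x" "cl y"] by (simp add: plus)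
    show "ksmult c x \<in> {x. cl x \<in> H.span (cl ` S)}" if "x \<in> {x. cl x \<in> H.span (cl ` S)}" for c x
      using that N.smult_closed [of c "cl x"] by (simp add: scale class_ring_simps)
  qed
  moreover have "S \<union> ?B \<subseteq> {x. cl x \<in> H.span (cl ` S)}"
    using H.in_own_span [OF G] cl_add [of _ 0] N.zero_closed by (auto simp: zero)
  ultimately have "kvs.span (S \<union> ?B) \<subseteq> {x. cl x \<in> H.span (cl ` S)}"
    by (rule kvs.span_minimal [rotated])
  then have gen: "H.gen_set (cl ` S)"
    using S(4) N.subset by (auto simp: carrier)
  then have "H.fin_dim"
    unfolding H.fin_dim_def using S(1) G by blast
  moreover have "H.dim \<le> m"
    using H.gen_ge_dim [OF _ G gen] S'(2) S(1,2) card_image_le [OF S(1), of cl] by simp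
  ultimately show ?thesis
    by (simp add: betti_number_def Let_def)
qed

section \<open>Attained covering type and the polynomial bound\<close>

lemma INF_enat_attained:
  assumes "(INF x\<in>A. f x) = enat n"
  obtains x where "x \<in> A" "f x = enat n"
proof -
  have "f ` A \<noteq> {}"
    using assms by (auto simp: top_enat_def)
  then obtain y where "y \<in> f ` A" by blast
  then have "(LEAST y. y \<in> f ` A) \<in> f ` A"
    by (rule LeastI)
  then have "enat n \<in> f ` A"
    using assms \<open>f ` A \<noteq> {}\<close> by (simp add: Inf_enat_def)
  then obtain x where "enat n = f x" "x \<in> A" by (rule imageE)
  then show thesis by (intro that [of x]) simp_all
qed

lemma covering_type_attained:
  fixes X :: "'a topology"
  assumes "covering_type X = enat n"
  obtains Y :: "('a \<times> real) topology" and \<U>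
  where "Y homotopy_equivalent_space X" "good_open_cover Y \<U>" "finite \<U>" "card \<U> = n"
proof -
  obtain Y :: "('a \<times> real) topology" where Y: "Y \<in> {Y. Y homotopy_equivalent_space X}"
    "strict_covering_type Y = enat n"
    using assms unfolding covering_type_def by (rule INF_enat_attained)
  obtain \<U> where "\<U> \<in> {\<U>. good_open_cover Y \<U>}" "(if finite \<U> then enat (card \<U>) else \<infinity>) = enat n"
    using Y(2) unfolding strict_covering_type_def by (rule INF_enat_attained)
  then show thesis
    using Y(1) by (intro that [of Y \<U>]) (auto split: if_splits)
qed

text \<open>The binomial expansion of \<open>(1 + t)^m\<close> has constant term 1; without it
  everything is a multiple of \<open>t\<close>, so the division is exact.\<close>

lemma binomial_quotient_poly:
  "([:1, 1:] ^ m - 1) div [:0, 1:] = (\<Sum>i<m. monom (int (m choose Suc i)) i)"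
proof -
  have "[:1, 1:] ^ m = (monom 1 1 + 1 :: int poly) ^ m"
    by (simp add: monom_altdef one_pCons)
  also have "\<dots> = (\<Sum>i\<le>m. monom (int (m choose i)) i)"
    by (simp add: binomial_ring monom_power of_nat_poly smult_monom)
  also have "\<dots> = 1 + [:0, 1:] * (\<Sum>i<m. monom (int (m choose Suc i)) i)"
    by (simp add: sum.atMost_shift sum_distrib_left monom_Suc)
  finally have eq: "[:1, 1:] ^ m - 1 = [:0, 1:] * (\<Sum>i<m. monom (int (m choose Suc i)) i)"
    by (simp only: add_diff_cancel_left')
  show ?thesis
    unfolding eq by (rule nonzero_mult_div_cancel_left) simp
qed

theorem theorem3p3:
  fixes X :: "'a topology" and n :: nat
  assumes "topspace X \<noteq> {}"
    and "covering_type X = enat n"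
  defines "h \<equiv> betti_number TYPE('k::field) X"
    and "P \<equiv> poincare_poly TYPE('k) X"
    and "Q \<equiv> ([:1, 1:] ^ (n - 1) - 1) div [:0, 1:] + 1 :: int poly"
  shows "coeffwise_le P Q \<and>
         Q = [:int n:] + (\<Sum>i = 1..n - 2. monom (int ((n - 1) choose (i + 1))) i) \<and>
         h 0 \<le> enat n \<and>
         (\<forall>i. 1 \<le> i \<and> i + 2 \<le> n \<longrightarrow> h i \<le> enat ((n - 1) choose (i + 1))) \<and>
         (\<forall>i. 1 \<le> i \<and> n \<le> i + 1 \<longrightarrow> h i = 0)"
proof -
  obtain Y :: "('a \<times> real) topology" and \<U> where Y: "Y homotopy_equivalent_space X"
    and \<U>: "good_open_cover Y \<U>" "finite \<U>" "card \<U> = n"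
    using covering_type_attained [OF assms(2)] by blast
  \<comment> \<open>A nonempty space has a nonempty cover, so \<open>n\<close> is positive and
    \<open>n - 1\<close> is a true predecessor.\<close>
  have "topspace Y \<noteq> {}"
  proof -
    obtain x g where "x \<in> topspace X" "continuous_map X Y g"
      using Y assms(1) unfolding homotopy_equivalent_space_def by blast
    then have "g x \<in> topspace Y"
      by (auto simp: continuous_map_def)
    then show ?thesis by blast
  qed
  then have "\<U> \<noteq> {}"
    using \<U>(1) unfolding good_open_cover_def by blast
  then obtain m where n: "n = Suc m"
    using \<U> by (metis card_eq_0_iff not0_implies_Suc)
  have h: "h i \<le> enat (if i = 0 then n else m choose Suc i)" for i
    unfolding h_def n
    using betti_number_le [OF rank_le_homotopy_equivalent [OF Y rank_le_kcycles_cover [OF \<U>(1,2)]]] \<U>(3) n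
    by blast
  have h0: "h i = 0" if "1 \<le> i" "n \<le> i + 1" for i
    using h [of i] that n by (simp add: binomial_eq_0 flip: zero_enat_def)
  \<comment> \<open>The added 1 raises the constant coefficient from \<open>m choose 1 = m\<close>
    to \<open>n\<close>.\<close>
  have Q: "coeff Q i = int (if i = 0 then n else m choose Suc i)" for i
    unfolding Q_def n by (auto simp: binomial_quotient_poly coeff_sum n binomial_eq_0)
  \<comment> \<open>\<open>Abs_poly\<close> returns the intended coefficients only for a sequence
    that is eventually zero.\<close>
  have "\<forall>\<^sub>\<infinity>i. int (the_enat (h i)) = 0"
    unfolding MOST_nat using h0 by (intro exI [of _ n]) (auto simp: zero_enat_def)
  then have P: "coeff P i = int (the_enat (h i))" for i
    unfolding P_def poincare_poly_def h_def by (simp add: Abs_poly_inverse)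
  have "coeff P i \<le> coeff Q i" for i
    \<comment> \<open>The bound excludes an infinite \<open>h i\<close>, so \<open>the_enat\<close>
      yields the actual Betti number.\<close>
    using h [of i] unfolding P Q by (cases "h i") auto
  moreover have "Q = [:int n:] + (\<Sum>i = 1..n - 2. monom (int ((n - 1) choose (i + 1))) i)"
    by (rule poly_eqI) (auto simp: Q coeff_sum n coeff_pCons binomial_eq_0 split: nat.split)
  moreover have "h i \<le> enat ((n - 1) choose (i + 1))" if "1 \<le> i" for i
    using h [of i] that n by simp
  moreover have "h 0 \<le> enat n"
    using h [of 0] by simp
  ultimately show ?thesis
    using h0 unfolding coeffwise_le_def by blast
qed

end
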